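(* Let $R$ be a $G$-graded ring such that $\mathrm{Spec}_G(R)$ with the Zariski topology is a Noetherian topological space, and let $M$ be a non-zero $G$-graded $R$-module that is both graded secondful and graded weak comultiplication. Then: (1) Every graded Zariski socle submodule $N$ of $M$ is the sum of a finite number of graded second submodules of $M$. (2) A graded submodule $N$ of $M$ is a graded Zariski socle submodule of $M$ if and only if $N=0$ or $N=\sum_{i=1}^n Ann_M(p_i)$ for some $n\in\mathbb{Z}^+$ and some $p_1,\dots,p_n\in V_G^R(Ann_R(N))$.
   Context: $G$ is an abelian group with identity $e$; all rings are commutative with unity $1$. A $G$-graded ring is a ring $R=\bigoplus_{g\in G}R_g$ with additive subgroups $R_g$ satisfying $R_gR_h\subseteq R_{gh}$; $h(R)=\bigcup_{g}R_g$. An ideal $I$ is graded ($I\lhd_G R$) if $I=\bigoplus_g (I\cap R_g)$. A graded prime ideal is a proper graded ideal $p$ such that for $a,b\in h(R)$, $ab\in p$ implies $a\in p$ or $b\in p$; $\mathrm{Spec}_G(R)$ is the set of all graded prime ideals, with the Zariski topology whose closed sets are $V_G^R(J)=\{p\in\mathrm{Spec}_G(R): J\subseteq p\}$, $J\lhd_G R$. A $G$-graded $R$-module is an $R$-module $M=\bigoplus_{g\in G}M_g$ with $R_gM_h\subseteq M_{gh}$; a submodule $N$ is graded ($N\leq_G M$) if $N=\bigoplus_g(N\cap M_g)$. $Ann_R(N)=\{r\in R: rN=0\}$ and $Ann_M(I)=\{m\in M: Im=0\}$. A non-zero graded submodule $S$ of $M$ is graded second if for every $r\in h(R)$, $rS=S$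 or $rS=0$ (then $Ann_R(S)$ is a graded prime ideal); $\mathrm{Spec}_G^s(M)$ is the set of all graded second submodules of $M$. For $N\leq_G M$, $V_G^s(N)=\{S\in \mathrm{Spec}_G^s(M): Ann_R(N)\subseteq Ann_R(S)\}$. The graded Zariski socle $Z.soc_G(N)$ is the sum of all members of $V_G^s(N)$ ($\{0\}$ if $V_G^s(N)=\emptyset$); $N$ is a graded Zariski socle submodule if $N=Z.soc_G(N)$. $M$ is graded secondful if the natural map $\phi:\mathrm{Spec}_G^s(M)\to \mathrm{Spec}_G(R/Ann_R(M))$, $S\mapsto Ann_R(S)/Ann_R(M)$, is surjective. $M$ is a graded weak comultiplication module if $\mathrm{Spec}_G^s(M)=\emptyset$ or every graded second submodule $S$ of $M$ has the form $S=Ann_M(I)$ for some graded ideal $I$ of $R$. A topological space is Noetherian if its closed sets satisfy the descending chain condition. Convention: $\{0\}$ is the sum of the empty family of graded second submodules. *)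

theory Defs
  imports "HOL-Analysis.Abstract_Topology" "HOL-Algebra.Module" "HOL-Algebra.QuotRing"
begin

section \<open>Internal direct sums and gradings\<close>

text \<open>
  The finitely supported families of the additive group \<^term>\<open>A\<close>, indexed by \<^term>\<open>K\<close>, whose
  component of index \<^term>\<open>g\<close> lies in \<^term>\<open>D g\<close>, and the sum of such a family. The sum is
  restricted to the support because \<^const>\<open>finsum\<close> over an infinite index set is zero by convention.
\<close>

definition families :: "('b, 'c) ring_scheme \<Rightarrow> 'g set \<Rightarrow> ('g \<Rightarrow> 'b set) \<Rightarrow> ('g \<Rightarrow> 'b) set" where
  "families A K D = {f \<in> (\<Pi>\<^sub>E g\<in>K. D g). finite {g \<in> K. f g \<noteq> \<zero>\<^bsub>A\<^esub>}}"

definition family_sum :: "('b, 'c) ring_scheme \<Rightarrow> 'g set \<Rightarrow> ('g \<Rightarrow> 'b) \<Rightarrow> 'b" where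
  "family_sum A K f = (\<Oplus>\<^bsub>A\<^esub> g \<in> {g \<in> K. f g \<noteq> \<zero>\<^bsub>A\<^esub>}. f g)"

text \<open>\<^term>\<open>T\<close> is the internal direct sum of the additive subgroups \<^term>\<open>D g\<close>.\<close>

definition is_direct_sum ::
    "('b, 'c) ring_scheme \<Rightarrow> 'g set \<Rightarrow> ('g \<Rightarrow> 'b set) \<Rightarrow> 'b set \<Rightarrow> bool" where
  "is_direct_sum A K D T \<longleftrightarrow>
     (\<forall>g\<in>K. additive_subgroup (D g) A) \<and> bij_betw (family_sum A K) (families A K D) T"

locale graded_ring = G: comm_group G + R: cring R
  for G :: "('g, 'k) monoid_scheme" and R :: "('a, 'r) ring_scheme"
    and RG :: "'g \<Rightarrow> 'a set" +
  assumes ring_direct_sum: "is_direct_sum R (carrier G) RG (carrier R)"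
    and ring_graded_mult: "\<lbrakk>g \<in> carrier G; h \<in> carrier G; a \<in> RG g; b \<in> RG h\<rbrakk>
      \<Longrightarrow> a \<otimes>\<^bsub>R\<^esub> b \<in> RG (g \<otimes>\<^bsub>G\<^esub> h)"

locale graded_module = graded_ring G R RG + Module.module R M
  for G :: "('g, 'k) monoid_scheme" and R :: "('a, 'r) ring_scheme"
    and RG :: "'g \<Rightarrow> 'a set"
    and M :: "('a, 'm, 'n) module_scheme" and MG :: "'g \<Rightarrow> 'm set" +
  assumes module_direct_sum: "is_direct_sum M (carrier G) MG (carrier M)"
    and module_graded_smult: "\<lbrakk>g \<in> carrier G; h \<in> carrier G; a \<in> RG g; x \<in> MG h\<rbrakk>
      \<Longrightarrow> a \<odot>\<^bsub>M\<^esub> x \<in> MG (g \<otimes>\<^bsub>G\<^esub> h)"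

definition homogeneous :: "('g, 'k) monoid_scheme \<Rightarrow> ('g \<Rightarrow> 'b set) \<Rightarrow> 'b set" where
  "homogeneous G D = (\<Union>g\<in>carrier G. D g)"

section \<open>The graded prime spectrum\<close>

definition graded_ideal ::
    "('g, 'k) monoid_scheme \<Rightarrow> ('a, 'r) ring_scheme \<Rightarrow> ('g \<Rightarrow> 'a set) \<Rightarrow> 'a set \<Rightarrow> bool" where
  "graded_ideal G R RG I \<longleftrightarrow>
     ideal I R \<and> is_direct_sum R (carrier G) (\<lambda>g. I \<inter> RG g) I"

definition graded_prime_ideal ::
    "('g, 'k) monoid_scheme \<Rightarrow> ('a, 'r) ring_scheme \<Rightarrow> ('g \<Rightarrow> 'a set) \<Rightarrow> 'a set \<Rightarrow> bool" where
  "graded_prime_ideal G R RG p \<longleftrightarrow>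
     graded_ideal G R RG p \<and> p \<noteq> carrier R \<and>
     (\<forall>a\<in>homogeneous G RG. \<forall>b\<in>homogeneous G RG. a \<otimes>\<^bsub>R\<^esub> b \<in> p \<longrightarrow> a \<in> p \<or> b \<in> p)"

definition graded_Spec ::
    "('g, 'k) monoid_scheme \<Rightarrow> ('a, 'r) ring_scheme \<Rightarrow> ('g \<Rightarrow> 'a set) \<Rightarrow> 'a set set" where
  "graded_Spec G R RG = {p. graded_prime_ideal G R RG p}"

definition graded_V ::
    "('g, 'k) monoid_scheme \<Rightarrow> ('a, 'r) ring_scheme \<Rightarrow> ('g \<Rightarrow> 'a set) \<Rightarrow> 'a set \<Rightarrow> 'a set set" where
  "graded_V G R RG J = {p \<in> graded_Spec G R RG. J \<subseteq> p}"

text \<open>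
  That these sets form a topology, so that \<^const>\<open>topology\<close> is meaningful here, is proved below for
  every graded ring.
\<close>

definition graded_Zariski ::
    "('g, 'k) monoid_scheme \<Rightarrow> ('a, 'r) ring_scheme \<Rightarrow> ('g \<Rightarrow> 'a set) \<Rightarrow> 'a set topology" where
  "graded_Zariski G R RG =
     topology (\<lambda>U. \<exists>J. graded_ideal G R RG J \<and> U = graded_Spec G R RG - graded_V G R RG J)"

definition noetherian_space :: "'x topology \<Rightarrow> bool" where
  "noetherian_space X \<longleftrightarrow>
     (\<forall>C :: nat \<Rightarrow> 'x set. (\<forall>n. closedin X (C n)) \<and> (\<forall>n. C (Suc n) \<subseteq> C n) \<longrightarrow>
        (\<exists>n. \<forall>m\<ge>n. C m = C n))"

lemma family_sum_mem:
  assumes A: "abelian_group A" and X: "additive_subgroup X A"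
    and f: "\<And>g. g \<in> K \<Longrightarrow> f g \<in> X"
  shows "family_sum A K f \<in> X"
proof -
  interpret abelian_group A by (rule A)
  interpret X: additive_subgroup X A by (rule X)
  have *: "(\<Oplus>\<^bsub>A\<^esub> g \<in> L. f g) \<in> X" if "finite L" "L \<subseteq> K" for L
    using that
  proof (induction L rule: finite_induct)
    case empty
    then show ?case by simp
  next
    case (insert a L)
    have "f \<in> L \<rightarrow> carrier A" "f a \<in> carrier A"
      using insert f X.a_subset by auto
    then show ?case using insert f by (simp add: finsum_insert)
  qed
  show ?thesis
  proof (cases "finite {g \<in> K. f g \<noteq> \<zero>\<^bsub>A\<^esub>}")
    case True
    then show ?thesis unfolding family_sum_def by (intro *) auto
  next
    case False
    then show ?thesis unfolding family_sum_def by (simp add: finsum_infinite)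
  qed
qed

context graded_ring
begin

lemma component_additive_subgroup:
  "g \<in> carrier G \<Longrightarrow> additive_subgroup (RG g) R"
  using ring_direct_sum by (simp add: is_direct_sum_def)

lemma graded_idealI:
  assumes I: "ideal I R"
    and comp: "\<And>f. \<lbrakk>f \<in> families R (carrier G) RG; family_sum R (carrier G) f \<in> I\<rbrakk>
      \<Longrightarrow> \<forall>g\<in>carrier G. f g \<in> I"
  shows "graded_ideal G R RG I"
proof -
  interpret I: ideal I R by (rule I)
  let ?F = "families R (carrier G) RG" and ?F' = "families R (carrier G) (\<lambda>g. I \<inter> RG g)"
  have sub: "?F' \<subseteq> ?F" by (auto simp: families_def)
  have bij: "bij_betw (family_sum R (carrier G)) ?F (carrier R)"
    using ring_direct_sum by (simp add: is_direct_sum_def)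
  have inj: "inj_on (family_sum R (carrier G)) ?F'"
    using bij sub by (meson bij_betw_imp_inj_on inj_on_subset)
  have "family_sum R (carrier G) ` ?F' = I"
  proof
    show "family_sum R (carrier G) ` ?F' \<subseteq> I"
      by (auto simp: families_def intro!: family_sum_mem[OF R.is_abelian_group I.is_additive_subgroup])
    show "I \<subseteq> family_sum R (carrier G) ` ?F'"
    proof
      fix x assume x: "x \<in> I"
      then have "x \<in> carrier R" using I.a_subset by auto
      then obtain f where f: "f \<in> ?F" "x = family_sum R (carrier G) f"
        using bij by (metis bij_betw_imp_surj_on imageE)
      then have "f \<in> ?F'" using comp[of f] x by (auto simp: families_def PiE_iff)
      then show "x \<in> family_sum R (carrier G) ` ?F'" using f by auto
    qed
  qed
  moreover have "additive_subgroup (I \<inter> RG g) R" if "g \<in> carrier G" for g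
    using component_additive_subgroup[OF that] I.is_additive_subgroup
    by (simp add: additive_subgroup_def R.add.subgroups_Inter_pair)
  ultimately show ?thesis
    using inj I by (simp add: graded_ideal_def is_direct_sum_def bij_betw_def)
qed

lemma graded_ideal_component:
  assumes I: "graded_ideal G R RG I" and f: "f \<in> families R (carrier G) RG"
    and s: "family_sum R (carrier G) f \<in> I" and g: "g \<in> carrier G"
  shows "f g \<in> I"
proof -
  let ?F = "families R (carrier G) RG" and ?F' = "families R (carrier G) (\<lambda>g. I \<inter> RG g)"
  have inj: "inj_on (family_sum R (carrier G)) ?F"
    using ring_direct_sum by (simp add: is_direct_sum_def bij_betw_def)
  have "family_sum R (carrier G) ` ?F' = I"
    using I by (simp add: graded_ideal_def is_direct_sum_def bij_betw_def)
  then have "family_sum R (carrier G) f \<in> family_sum R (carrier G) ` ?F'" using s by (simp only:)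
  then obtain f' where f': "f' \<in> ?F'" "family_sum R (carrier G) f' = family_sum R (carrier G) f"
    by (elim imageE) simp
  moreover have "f' \<in> ?F" using f'(1) by (auto simp: families_def)
  ultimately have "f' = f" using inj f by (auto dest: inj_onD)
  then show ?thesis using f' g by (auto simp: families_def)
qed

lemma graded_ideal_carrier: "graded_ideal G R RG (carrier R)"
proof (rule graded_idealI)
  show "ideal (carrier R) R" by (rule R.oneideal)
next
  fix f assume "f \<in> families R (carrier G) RG"
  then show "\<forall>g\<in>carrier G. f g \<in> carrier R"
    using component_additive_subgroup additive_subgroup.a_subset
    by (fastforce simp: families_def)
qed

lemma graded_ideal_Inter:
  assumes "S \<noteq> {}" and "\<And>I. I \<in> S \<Longrightarrow> graded_ideal G R RG I"
  shows "graded_ideal G R RG (\<Inter>S)"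
proof (rule graded_idealI)
  show "ideal (\<Inter>S) R"
    using assms by (intro R.i_Intersect) (auto simp: graded_ideal_def)
next
  fix f assume "f \<in> families R (carrier G) RG" "family_sum R (carrier G) f \<in> \<Inter>S"
  then show "\<forall>g\<in>carrier G. f g \<in> \<Inter>S"
    using assms graded_ideal_component by blast
qed

lemma graded_ideal_not_subset:
  assumes I: "graded_ideal G R RG I" and p: "graded_ideal G R RG p" and "\<not> I \<subseteq> p"
  obtains a where "a \<in> I" "a \<in> homogeneous G RG" "a \<notin> p"
proof -
  let ?F' = "families R (carrier G) (\<lambda>g. I \<inter> RG g)"
  obtain x where x: "x \<in> I" "x \<notin> p" using assms by auto
  have "family_sum R (carrier G) ` ?F' = I"
    using I by (simp add: graded_ideal_def is_direct_sum_def bij_betw_def)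
  then have "x \<in> family_sum R (carrier G) ` ?F'" using x by (simp only:)
  then obtain f where f: "f \<in> ?F'" "family_sum R (carrier G) f = x" by (elim imageE) simp
  have "additive_subgroup p R" using p by (simp add: graded_ideal_def ideal_def)
  then have "\<exists>g\<in>carrier G. f g \<notin> p"
    using family_sum_mem[OF R.is_abelian_group, of p "carrier G" f] f x by auto
  then obtain g where "g \<in> carrier G" "f g \<notin> p" by auto
  moreover have "f g \<in> I \<inter> RG g" using f \<open>g \<in> carrier G\<close> by (auto simp: families_def)
  ultimately show thesis using that by (auto simp: homogeneous_def)
qed

lemma graded_V_Int:
  assumes I: "graded_ideal G R RG I" and J: "graded_ideal G R RG J"
  shows "graded_V G R RG (I \<inter> J) = graded_V G R RG I \<union> graded_V G R RG J"
proof
  show "graded_V G R RG (I \<inter> J) \<subseteq> graded_V G R RG I \<union> graded_V G R RG J"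
  proof
    fix p assume "p \<in> graded_V G R RG (I \<inter> J)"
    then have p: "graded_prime_ideal G R RG p" "I \<inter> J \<subseteq> p"
      by (auto simp: graded_V_def graded_Spec_def)
    have gp: "graded_ideal G R RG p" using p by (simp add: graded_prime_ideal_def)
    have "I \<subseteq> p \<or> J \<subseteq> p"
    proof (rule ccontr)
      assume "\<not> (I \<subseteq> p \<or> J \<subseteq> p)"
      then obtain a b where ab: "a \<in> I" "a \<in> homogeneous G RG" "a \<notin> p"
          "b \<in> J" "b \<in> homogeneous G RG" "b \<notin> p"
        using graded_ideal_not_subset[OF I gp] graded_ideal_not_subset[OF J gp] by metis
      interpret I: ideal I R using I by (simp add: graded_ideal_def)
      interpret J: ideal J R using J by (simp add: graded_ideal_def)
      have "a \<otimes>\<^bsub>R\<^esub> b \<in> I \<inter> J"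
        using I.I_r_closed[OF ab(1) J.a_Hcarr[OF ab(4)]] J.I_l_closed[OF ab(4) I.a_Hcarr[OF ab(1)]]
        by (rule IntI)
      then show False using p ab by (auto simp: graded_prime_ideal_def)
    qed
    then show "p \<in> graded_V G R RG I \<union> graded_V G R RG J"
      using p by (auto simp: graded_V_def graded_Spec_def)
  qed
qed (auto simp: graded_V_def)

lemma istopology_graded_Zariski:
  "istopology (\<lambda>U. \<exists>J. graded_ideal G R RG J \<and> U = graded_Spec G R RG - graded_V G R RG J)"
    (is "istopology ?L")
  unfolding istopology_def
proof (intro conjI allI impI)
  fix S T assume "?L S" "?L T"
  then obtain I J where IJ: "graded_ideal G R RG I" "S = graded_Spec G R RG - graded_V G R RG I"
      "graded_ideal G R RG J" "T = graded_Spec G R RG - graded_V G R RG J" by blast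
  have "graded_ideal G R RG (I \<inter> J)" using graded_ideal_Inter[of "{I, J}"] IJ by auto
  moreover have "S \<inter> T = graded_Spec G R RG - graded_V G R RG (I \<inter> J)"
    using IJ graded_V_Int by auto
  ultimately show "?L (S \<inter> T)" by blast
next
  fix \<K> assume K: "\<forall>K\<in>\<K>. ?L K"
  then obtain J where J: "\<And>K. K \<in> \<K> \<Longrightarrow> graded_ideal G R RG (J K)"
      "\<And>K. K \<in> \<K> \<Longrightarrow> K = graded_Spec G R RG - graded_V G R RG (J K)" by metis
  define S where "S = {I. graded_ideal G R RG I \<and> (\<Union>K\<in>\<K>. J K) \<subseteq> I}"
  have "(\<Union>K\<in>\<K>. J K) \<subseteq> carrier R"
    using J(1) by (auto simp: graded_ideal_def dest!: ideal.axioms(1) additive_subgroup.a_subset)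
  then have "carrier R \<in> S" using graded_ideal_carrier by (auto simp: S_def)
  then have "graded_ideal G R RG (\<Inter>S)"
    by (intro graded_ideal_Inter) (auto simp: S_def)
  moreover have "\<Union>\<K> = graded_Spec G R RG - graded_V G R RG (\<Inter>S)"
  proof -
    have "\<Inter>S \<subseteq> p \<longleftrightarrow> (\<forall>K\<in>\<K>. J K \<subseteq> p)" if "p \<in> graded_Spec G R RG" for p
    proof
      assume "\<Inter>S \<subseteq> p"
      then show "\<forall>K\<in>\<K>. J K \<subseteq> p" by (auto simp: S_def)
    next
      assume "\<forall>K\<in>\<K>. J K \<subseteq> p"
      then have "p \<in> S" using that by (auto simp: S_def graded_Spec_def graded_prime_ideal_def)
      then show "\<Inter>S \<subseteq> p" by auto
    qed
    moreover have "p \<in> \<Union>\<K> \<longleftrightarrow> p \<in> graded_Spec G R RG \<and> (\<exists>K\<in>\<K>. \<not> J K \<subseteq> p)" for p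
    proof -
      have "p \<in> K \<longleftrightarrow> p \<in> graded_Spec G R RG \<and> \<not> J K \<subseteq> p" if "K \<in> \<K>" for K
        using J(2)[OF that] unfolding graded_V_def by blast
      then show ?thesis by blast
    qed
    moreover have "p \<in> graded_Spec G R RG - graded_V G R RG (\<Inter>S) \<longleftrightarrow>
        p \<in> graded_Spec G R RG \<and> \<not> \<Inter>S \<subseteq> p" for p
      unfolding graded_V_def by blast
    ultimately have "p \<in> \<Union>\<K> \<longleftrightarrow> p \<in> graded_Spec G R RG - graded_V G R RG (\<Inter>S)" for p
      by metis
    then show ?thesis by (rule Set.set_eqI)
  qed
  ultimately show "?L (\<Union>\<K>)" by blast
qed

lemma openin_graded_Zariski:
  "openin (graded_Zariski G R RG) U \<longleftrightarrow>
     (\<exists>J. graded_ideal G R RG J \<and> U = graded_Spec G R RG - graded_V G R RG J)"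
  unfolding graded_Zariski_def topology_inverse'[OF istopology_graded_Zariski] ..

lemma topspace_graded_Zariski: "topspace (graded_Zariski G R RG) = graded_Spec G R RG"
proof -
  have "graded_V G R RG (carrier R) = {}"
    by (auto simp: graded_V_def graded_Spec_def graded_prime_ideal_def graded_ideal_def
        dest!: ideal.axioms(1) additive_subgroup.a_subset)
  then have "openin (graded_Zariski G R RG) (graded_Spec G R RG)"
    unfolding openin_graded_Zariski using graded_ideal_carrier by (metis Diff_empty)
  then show ?thesis
    unfolding topspace_def using openin_graded_Zariski by blast
qed

lemma closedin_graded_Zariski:
  "closedin (graded_Zariski G R RG) C \<longleftrightarrow> (\<exists>J. graded_ideal G R RG J \<and> C = graded_V G R RG J)"
proof -
  have V: "graded_V G R RG J \<subseteq> graded_Spec G R RG" for J by (auto simp: graded_V_def)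
  show ?thesis
    unfolding closedin_def topspace_graded_Zariski openin_graded_Zariski using V by blast
qed

end

section \<open>Graded second submodules\<close>

definition graded_submodule ::
    "('g, 'k) monoid_scheme \<Rightarrow> ('a, 'r) ring_scheme \<Rightarrow> ('a, 'm, 'n) module_scheme \<Rightarrow>
     ('g \<Rightarrow> 'm set) \<Rightarrow> 'm set \<Rightarrow> bool" where
  "graded_submodule G R M MG N \<longleftrightarrow>
     submodule N R M \<and> is_direct_sum M (carrier G) (\<lambda>g. N \<inter> MG g) N"

definition Ann_ring ::
    "('a, 'r) ring_scheme \<Rightarrow> ('a, 'm, 'n) module_scheme \<Rightarrow> 'm set \<Rightarrow> 'a set" where
  "Ann_ring R M N = {r \<in> carrier R. \<forall>x\<in>N. r \<odot>\<^bsub>M\<^esub> x = \<zero>\<^bsub>M\<^esub>}"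

definition Ann_module :: "('a, 'm, 'n) module_scheme \<Rightarrow> 'a set \<Rightarrow> 'm set" where
  "Ann_module M I = {x \<in> carrier M. \<forall>r\<in>I. r \<odot>\<^bsub>M\<^esub> x = \<zero>\<^bsub>M\<^esub>}"

definition graded_second ::
    "('g, 'k) monoid_scheme \<Rightarrow> ('a, 'r) ring_scheme \<Rightarrow> ('g \<Rightarrow> 'a set) \<Rightarrow>
     ('a, 'm, 'n) module_scheme \<Rightarrow> ('g \<Rightarrow> 'm set) \<Rightarrow> 'm set \<Rightarrow> bool" where
  "graded_second G R RG M MG S \<longleftrightarrow>
     graded_submodule G R M MG S \<and> S \<noteq> {\<zero>\<^bsub>M\<^esub>} \<and>
     (\<forall>r\<in>homogeneous G RG. (\<lambda>x. r \<odot>\<^bsub>M\<^esub> x) ` S = S \<or> (\<lambda>x. r \<odot>\<^bsub>M\<^esub> x) ` S = {\<zero>\<^bsub>M\<^esub>})"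

definition second_Spec ::
    "('g, 'k) monoid_scheme \<Rightarrow> ('a, 'r) ring_scheme \<Rightarrow> ('g \<Rightarrow> 'a set) \<Rightarrow>
     ('a, 'm, 'n) module_scheme \<Rightarrow> ('g \<Rightarrow> 'm set) \<Rightarrow> 'm set set" where
  "second_Spec G R RG M MG = {S. graded_second G R RG M MG S}"

definition second_V ::
    "('g, 'k) monoid_scheme \<Rightarrow> ('a, 'r) ring_scheme \<Rightarrow> ('g \<Rightarrow> 'a set) \<Rightarrow>
     ('a, 'm, 'n) module_scheme \<Rightarrow> ('g \<Rightarrow> 'm set) \<Rightarrow> 'm set \<Rightarrow> 'm set set" where
  "second_V G R RG M MG N =
     {S \<in> second_Spec G R RG M MG. Ann_ring R M N \<subseteq> Ann_ring R M S}"

text \<open>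
  The sum of an arbitrary indexed family of submodules: all finite sums of elements of its members.
  For an empty index set this is the zero submodule.
\<close>

definition submodule_sum ::
    "('a, 'm, 'n) module_scheme \<Rightarrow> 'i set \<Rightarrow> ('i \<Rightarrow> 'm set) \<Rightarrow> 'm set" where
  "submodule_sum M I N =
     {(\<Oplus>\<^bsub>M\<^esub> i \<in> J. f i) | J f. finite J \<and> J \<subseteq> I \<and> (\<forall>i\<in>J. f i \<in> N i)}"

definition Zariski_socle ::
    "('g, 'k) monoid_scheme \<Rightarrow> ('a, 'r) ring_scheme \<Rightarrow> ('g \<Rightarrow> 'a set) \<Rightarrow>
     ('a, 'm, 'n) module_scheme \<Rightarrow> ('g \<Rightarrow> 'm set) \<Rightarrow> 'm set \<Rightarrow> 'm set" where
  "Zariski_socle G R RG M MG N = submodule_sum M (second_V G R RG M MG N) (\<lambda>S. S)"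

definition Zariski_socle_submodule ::
    "('g, 'k) monoid_scheme \<Rightarrow> ('a, 'r) ring_scheme \<Rightarrow> ('g \<Rightarrow> 'a set) \<Rightarrow>
     ('a, 'm, 'n) module_scheme \<Rightarrow> ('g \<Rightarrow> 'm set) \<Rightarrow> 'm set \<Rightarrow> bool" where
  "Zariski_socle_submodule G R RG M MG N \<longleftrightarrow>
     graded_submodule G R M MG N \<and> N = Zariski_socle G R RG M MG N"

text \<open>The image of \<^term>\<open>J\<close> in the quotient ring \<^term>\<open>R Quot I\<close>; elements of the latter are cosets.\<close>

definition quot_image ::
    "('a, 'r) ring_scheme \<Rightarrow> 'a set \<Rightarrow> 'a set \<Rightarrow> 'a set set" where
  "quot_image R I J = (\<lambda>r. I +>\<^bsub>R\<^esub> r) ` J"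

text \<open>
  The quotient \<^term>\<open>R Quot I\<close> carries the grading by the images of the components of \<^term>\<open>R\<close>.
\<close>

definition graded_secondful ::
    "('g, 'k) monoid_scheme \<Rightarrow> ('a, 'r) ring_scheme \<Rightarrow> ('g \<Rightarrow> 'a set) \<Rightarrow>
     ('a, 'm, 'n) module_scheme \<Rightarrow> ('g \<Rightarrow> 'm set) \<Rightarrow> bool" where
  "graded_secondful G R RG M MG \<longleftrightarrow>
     (let A = Ann_ring R M (carrier M) in
        (\<lambda>S. quot_image R A (Ann_ring R M S)) ` second_Spec G R RG M MG =
        graded_Spec G (R Quot A) (\<lambda>g. quot_image R A (RG g)))"

definition graded_weak_comultiplication ::
    "('g, 'k) monoid_scheme \<Rightarrow> ('a, 'r) ring_scheme \<Rightarrow> ('g \<Rightarrow> 'a set) \<Rightarrow>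
     ('a, 'm, 'n) module_scheme \<Rightarrow> ('g \<Rightarrow> 'm set) \<Rightarrow> bool" where
  "graded_weak_comultiplication G R RG M MG \<longleftrightarrow>
     second_Spec G R RG M MG = {} \<or>
     (\<forall>S\<in>second_Spec G R RG M MG. \<exists>I. graded_ideal G R RG I \<and> S = Ann_module M I)"

end

theory Submission
  imports Defs
begin

text \<open>
  Secondfulness and the weak comultiplication property make \<open>S \<mapsto> Ann\<^sub>R(S)\<close> and \<open>p \<mapsto> Ann\<^sub>M(p)\<close> mutually
  inverse, inclusion-reversing bijections between the graded second submodules of \<open>M\<close> and the graded
  primes of \<open>R\<close> containing \<open>Ann\<^sub>R(M)\<close>. Hence the Zariski socle of \<open>N\<close> is the sum of the \<open>Ann\<^sub>M(p)\<close> over all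
  \<open>p \<supseteq> Ann\<^sub>R(N)\<close>. In a Noetherian spectrum finitely many of these \<open>p\<close> lie below all the others, so their
  annihilators already give the whole sum. Conversely, if \<open>N\<close> is a finite sum of \<open>Ann\<^sub>M(p\<^sub>i)\<close>, then \<open>Ann\<^sub>R(N)\<close>
  contains the intersection of the \<open>p\<^sub>i\<close>, so every prime above \<open>Ann\<^sub>R(N)\<close> contains some \<open>p\<^sub>i\<close>.
\<close>

section \<open>Finitely supported sums, and cosets of an ideal\<close>

text \<open>\<open>family_sum\<close> runs over the exact support, which changes under differences
  and homomorphisms. Padding with zeros lets several families be summed over one common finite
  set.\<close>

lemma (in abelian_monoid) family_sum_eq_finsum:
  assumes "finite L" "{g \<in> K. f g \<noteq> \<zero>} \<subseteq> L" "L \<subseteq> K" "f \<in> L \<rightarrow> carrier G"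
  shows "family_sum G K f = (\<Oplus>g\<in>L. f g)"
  unfolding family_sum_def
  by (rule add.finprod_mono_neutral_cong_left) (use assms in auto)

lemma direct_sum_components:
  assumes "is_direct_sum A K D T" "x \<in> T"
  obtains f where "f \<in> families A K D" "family_sum A K f = x"
  using assms unfolding is_direct_sum_def bij_betw_def by (metis imageE)

lemma ideal_subset_carrier: "ideal I R \<Longrightarrow> I \<subseteq> carrier R"
  by (rule additive_subgroup.a_subset[OF ideal.axioms(1)])

context ring
begin

lemma rcos_eq_zero_iff:
  assumes "ideal A R" "x \<in> carrier R"
  shows "A +> x = \<zero>\<^bsub>R Quot A\<^esub> \<longleftrightarrow> x \<in> A"
proof -
  interpret A: ideal A R by (rule assms(1))
  have "\<zero>\<^bsub>R Quot A\<^esub> = A" by (simp add: FactRing_def)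
  then show ?thesis
    using A.a_rcos_self[OF assms(2)] a_coset_join2[OF assms(2) A.a_subgroup] by auto
qed

text \<open>Since \<open>A\<close> lies in \<open>p\<close>, the ideal \<open>p\<close> is a union
  of cosets of \<open>A\<close>, so membership can be tested on any representative.\<close>

lemma rcos_mem_quot_image_iff:
  assumes A: "ideal A R" and p: "ideal p R" and Ap: "A \<subseteq> p" and x: "x \<in> carrier R"
  shows "A +> x \<in> quot_image R A p \<longleftrightarrow> x \<in> p"
proof
  interpret A: ideal A R by (rule A)
  interpret p: ideal p R by (rule p)
  assume "A +> x \<in> quot_image R A p"
  then obtain y where y: "y \<in> p" "A +> x = A +> y" by (auto simp: quot_image_def)
  then have "x \<in> A +> y" using A.a_rcos_self[OF x] by simp
  then obtain a where "a \<in> A" "x = a \<oplus> y" by (auto simp: a_r_coset_def')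
  then show "x \<in> p" using Ap y(1) by auto
qed (simp add: quot_image_def)

lemma inj_on_quot_image: "ideal A R \<Longrightarrow> inj_on (quot_image R A) {I. ideal I R \<and> A \<subseteq> I}"
  using quot_ideal_correspondence[of A] unfolding bij_betw_def quot_image_def by simp

end

section \<open>Graded ideals and graded primes of a quotient ring\<close>

context graded_ring
begin

lemma homogeneous_subset: "homogeneous G RG \<subseteq> carrier R"
  using component_additive_subgroup additive_subgroup.a_subset
  by (fastforce simp: homogeneous_def)

text \<open>Directness of the sum rests on \<open>A\<close> being graded: two families of cosets
  with the same sum lift to families in \<open>R\<close> whose difference sums into
  \<open>A\<close>, so each component of the difference lies in \<open>A\<close> and the cosets
  agree. That the sums fill the image follows by decomposing elements of \<open>p\<close> inside
  \<open>p\<close>.\<close>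

lemma graded_ideal_quot_image:
  assumes A: "graded_ideal G R RG A" and p: "graded_ideal G R RG p" and Ap: "A \<subseteq> p"
  shows "graded_ideal G (R Quot A) (\<lambda>g. quot_image R A (RG g)) (quot_image R A p)"
proof -
  let ?Q = "R Quot A" and ?h = "\<lambda>r. A +>\<^bsub>R\<^esub> r" and ?q = "quot_image R A p"
  let ?C = "\<lambda>g. quot_image R A (RG g)" and ?K = "carrier G"
  have iA: "ideal A R" and ip: "ideal p R"
    using A p by (simp_all add: graded_ideal_def)
  interpret h: ring_hom_cring R ?Q ?h
    using ideal.rcos_ring_hom_cring[OF iA R.is_cring] .
  have hr: "ring_hom_ring R ?Q ?h" by (rule ideal.rcos_ring_hom_ring[OF iA])
  have idq: "ideal ?q ?Q"
    unfolding quot_image_def by (rule R.ring_ideal_imp_quot_ideal[OF iA ip])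
  have RGsub: "RG g \<subseteq> carrier R" if "g \<in> ?K" for g
    using component_additive_subgroup[OF that] additive_subgroup.a_subset by blast
  have addC: "additive_subgroup (?q \<inter> ?C g) ?Q" if g: "g \<in> ?K" for g
  proof -
    have "subgroup (?C g) (add_monoid ?Q)"
      using ring_hom_ring.img_is_add_subgroup[OF hr] component_additive_subgroup[OF g]
      unfolding quot_image_def additive_subgroup_def by blast
    moreover have "subgroup ?q (add_monoid ?Q)"
      using idq by (simp add: ideal_def additive_subgroup_def)
    ultimately show ?thesis
      unfolding additive_subgroup_def by (intro h.S.add.subgroups_Inter_pair)
  qed
  \<comment> \<open>Each coset gets a homogeneous representative. The zero coset must get 0, since
    an arbitrary choice there could make the support of the lifted family infinite.\<close>
  have lift: "\<exists>f. f \<in> families R ?K RG \<and> {g \<in> ?K. f g \<noteq> \<zero>\<^bsub>R\<^esub>} \<subseteq> {g \<in> ?K. F g \<noteq> \<zero>\<^bsub>?Q\<^esub>} \<and>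
      (\<forall>g\<in>?K. F g = ?h (f g))"
    if F: "F \<in> families ?Q ?K (\<lambda>g. ?q \<inter> ?C g)" for F
  proof -
    have "\<forall>g\<in>?K. \<exists>r. r \<in> RG g \<and> F g = ?h r \<and> (F g = \<zero>\<^bsub>?Q\<^esub> \<longrightarrow> r = \<zero>\<^bsub>R\<^esub>)"
    proof
      fix g assume g: "g \<in> ?K"
      show "\<exists>r. r \<in> RG g \<and> F g = ?h r \<and> (F g = \<zero>\<^bsub>?Q\<^esub> \<longrightarrow> r = \<zero>\<^bsub>R\<^esub>)"
      proof (cases "F g = \<zero>\<^bsub>?Q\<^esub>")
        case True
        then show ?thesis
          using additive_subgroup.zero_closed[OF component_additive_subgroup[OF g]]
          by (intro exI[of _ "\<zero>\<^bsub>R\<^esub>"]) simp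
      next
        case False
        have "F g \<in> ?C g" using F g by (auto simp: families_def)
        then obtain r where "r \<in> RG g" "F g = ?h r" by (auto simp: quot_image_def)
        then show ?thesis using False by blast
      qed
    qed
    then obtain f where f: "\<And>g. g \<in> ?K \<Longrightarrow> f g \<in> RG g \<and> F g = ?h (f g) \<and>
        (F g = \<zero>\<^bsub>?Q\<^esub> \<longrightarrow> f g = \<zero>\<^bsub>R\<^esub>)"
      by metis
    then have fRG: "f g \<in> RG g" and Ff: "F g = ?h (f g)" if "g \<in> ?K" for g
      using that by blast+
    have sub: "{g \<in> ?K. f g \<noteq> \<zero>\<^bsub>R\<^esub>} \<subseteq> {g \<in> ?K. F g \<noteq> \<zero>\<^bsub>?Q\<^esub>}" using f by blast
    have "finite {g \<in> ?K. F g \<noteq> \<zero>\<^bsub>?Q\<^esub>}" using F by (simp add: families_def)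
    then have "finite {g \<in> ?K. f g \<noteq> \<zero>\<^bsub>R\<^esub>}" using sub by (rule rev_finite_subset)
    moreover have res: "{g \<in> ?K. restrict f ?K g \<noteq> \<zero>\<^bsub>R\<^esub>} = {g \<in> ?K. f g \<noteq> \<zero>\<^bsub>R\<^esub>}" by auto
    moreover have "restrict f ?K \<in> (\<Pi>\<^sub>E g\<in>?K. RG g)"
      using fRG by (simp add: PiE_iff)
    ultimately have "restrict f ?K \<in> families R ?K RG"
      unfolding families_def by simp
    moreover have "\<forall>g\<in>?K. F g = ?h (restrict f ?K g)" using Ff by simp
    moreover note sub[folded res]
    ultimately show ?thesis by blast
  qed
  have inj: "inj_on (family_sum ?Q ?K) (families ?Q ?K (\<lambda>g. ?q \<inter> ?C g))"
  proof (rule inj_onI)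
    fix F F'
    assume F: "F \<in> families ?Q ?K (\<lambda>g. ?q \<inter> ?C g)" and F': "F' \<in> families ?Q ?K (\<lambda>g. ?q \<inter> ?C g)"
      and eq: "family_sum ?Q ?K F = family_sum ?Q ?K F'"
    obtain f f' where f: "f \<in> families R ?K RG" "{g \<in> ?K. f g \<noteq> \<zero>\<^bsub>R\<^esub>} \<subseteq> {g \<in> ?K. F g \<noteq> \<zero>\<^bsub>?Q\<^esub>}"
        "\<forall>g\<in>?K. F g = ?h (f g)"
      and f': "f' \<in> families R ?K RG" "{g \<in> ?K. f' g \<noteq> \<zero>\<^bsub>R\<^esub>} \<subseteq> {g \<in> ?K. F' g \<noteq> \<zero>\<^bsub>?Q\<^esub>}"
        "\<forall>g\<in>?K. F' g = ?h (f' g)"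
      using lift[OF F] lift[OF F'] by blast
    \<comment> \<open>A common finite index set containing the supports of \<open>F\<close>,
      \<open>F'\<close> and both lifts, hence that of their difference \<open>d\<close>.\<close>
    define L where "L = {g \<in> ?K. F g \<noteq> \<zero>\<^bsub>?Q\<^esub>} \<union> {g \<in> ?K. F' g \<noteq> \<zero>\<^bsub>?Q\<^esub>}"
    have L: "finite L" "L \<subseteq> ?K" using F F' by (auto simp: L_def families_def)
    define d where "d = (\<lambda>g\<in>?K. f g \<ominus>\<^bsub>R\<^esub> f' g)"
    have fR: "f g \<in> RG g" "f' g \<in> RG g" if "g \<in> ?K" for g
      using f f' that by (auto simp: families_def)
    have fc: "f g \<in> carrier R" "f' g \<in> carrier R" "d g \<in> carrier R" if "g \<in> ?K" for g
      using fR[OF that] RGsub[OF that] that by (auto simp: d_def)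
    have f0: "f g = \<zero>\<^bsub>R\<^esub>" "f' g = \<zero>\<^bsub>R\<^esub>" if "g \<in> ?K" "g \<notin> L" for g
      using that f(2) f'(2) by (auto simp: L_def)
    have "d g = \<zero>\<^bsub>R\<^esub>" if "g \<in> ?K" "g \<notin> L" for g
      using f0[OF that] that by (simp add: d_def R.minus_eq)
    then have dsupp: "{g \<in> ?K. d g \<noteq> \<zero>\<^bsub>R\<^esub>} \<subseteq> L" by blast
    have dRG: "d g \<in> RG g" if "g \<in> ?K" for g
      using fR[OF that] component_additive_subgroup[OF that] that
      by (simp add: d_def R.minus_eq additive_subgroup.a_closed additive_subgroup.a_inv_closed)
    have "d \<in> (\<Pi>\<^sub>E g\<in>?K. RG g)" using dRG by (simp add: PiE_iff d_def)
    then have d: "d \<in> families R ?K RG"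
      using finite_subset[OF dsupp L(1)] by (simp add: families_def)
    have "family_sum ?Q ?K F = (\<Oplus>\<^bsub>?Q\<^esub>g\<in>L. F g)"
      by (rule h.S.family_sum_eq_finsum) (use L fc f(3) in \<open>auto simp: L_def\<close>)
    also have "\<dots> = (\<Oplus>\<^bsub>?Q\<^esub>g\<in>L. (?h \<circ> f) g)"
      by (rule h.S.finsum_cong') (use L fc f(3) in auto)
    also have "\<dots> = ?h (\<Oplus>\<^bsub>R\<^esub>g\<in>L. f g)"
      by (rule h.hom_finsum[symmetric]) (use L fc in auto)
    finally have 1: "family_sum ?Q ?K F = ?h (\<Oplus>\<^bsub>R\<^esub>g\<in>L. f g)" .
    have "family_sum ?Q ?K F' = (\<Oplus>\<^bsub>?Q\<^esub>g\<in>L. F' g)"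
      by (rule h.S.family_sum_eq_finsum) (use L fc f'(3) in \<open>auto simp: L_def\<close>)
    also have "\<dots> = (\<Oplus>\<^bsub>?Q\<^esub>g\<in>L. (?h \<circ> f') g)"
      by (rule h.S.finsum_cong') (use L fc f'(3) in auto)
    also have "\<dots> = ?h (\<Oplus>\<^bsub>R\<^esub>g\<in>L. f' g)"
      by (rule h.hom_finsum[symmetric]) (use L fc in auto)
    finally have 2: "family_sum ?Q ?K F' = ?h (\<Oplus>\<^bsub>R\<^esub>g\<in>L. f' g)" .
    \<comment> \<open>With \<open>f\<close> written as \<open>f' + d\<close>, equality of the two
      sums of cosets amounts to the sum of \<open>d\<close> having zero coset.\<close>
    have fd: "f g = f' g \<oplus>\<^bsub>R\<^esub> d g" if "g \<in> ?K" for g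
      using fc[OF that] that R.a_lcomm[of "f' g" "f g" "\<ominus>\<^bsub>R\<^esub> f' g"]
      by (simp add: d_def R.minus_eq R.r_neg)
    have "(\<Oplus>\<^bsub>R\<^esub>g\<in>L. f g) = (\<Oplus>\<^bsub>R\<^esub>g\<in>L. f' g \<oplus>\<^bsub>R\<^esub> d g)"
      by (rule R.finsum_cong') (use L fc fd in auto)
    also have "\<dots> = (\<Oplus>\<^bsub>R\<^esub>g\<in>L. f' g) \<oplus>\<^bsub>R\<^esub> (\<Oplus>\<^bsub>R\<^esub>g\<in>L. d g)"
      by (rule R.finsum_addf) (use L fc in auto)
    finally have 3: "(\<Oplus>\<^bsub>R\<^esub>g\<in>L. f g) = (\<Oplus>\<^bsub>R\<^esub>g\<in>L. f' g) \<oplus>\<^bsub>R\<^esub> (\<Oplus>\<^bsub>R\<^esub>g\<in>L. d g)" .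
    have c: "(\<Oplus>\<^bsub>R\<^esub>g\<in>L. f' g) \<in> carrier R" "(\<Oplus>\<^bsub>R\<^esub>g\<in>L. d g) \<in> carrier R"
      using L fc by (auto intro!: R.finsum_closed)
    have "?h (\<Oplus>\<^bsub>R\<^esub>g\<in>L. f' g) = ?h (\<Oplus>\<^bsub>R\<^esub>g\<in>L. f' g) \<oplus>\<^bsub>?Q\<^esub> ?h (\<Oplus>\<^bsub>R\<^esub>g\<in>L. d g)"
      using eq[unfolded 1 2 3] h.hom_add[OF c] by simp
    then have "?h (\<Oplus>\<^bsub>R\<^esub>g\<in>L. d g) = \<zero>\<^bsub>?Q\<^esub>"
      using h.S.add.l_cancel_one'[OF h.hom_closed[OF c(1)] h.hom_closed[OF c(2)]] by simp
    then have "(\<Oplus>\<^bsub>R\<^esub>g\<in>L. d g) \<in> A"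
      using R.rcos_eq_zero_iff[OF iA] c by simp
    moreover have "family_sum R ?K d = (\<Oplus>\<^bsub>R\<^esub>g\<in>L. d g)"
      by (rule R.family_sum_eq_finsum) (use L fc dsupp in auto)
    ultimately have dA: "d g \<in> A" if "g \<in> ?K" for g
      using graded_ideal_component[OF A d _ that] by simp
    show "F = F'"
    proof (rule PiE_ext)
      show "F \<in> (\<Pi>\<^sub>E g\<in>?K. ?q \<inter> ?C g)" "F' \<in> (\<Pi>\<^sub>E g\<in>?K. ?q \<inter> ?C g)"
        using F F' by (auto simp: families_def)
      fix g assume g: "g \<in> ?K"
      have "?h (d g) = \<zero>\<^bsub>?Q\<^esub>" using R.rcos_eq_zero_iff[OF iA] dA[OF g] fc[OF g] by simp
      then have "?h (f g) = ?h (f' g)"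
        using fd[OF g] fc[OF g] by simp
      then show "F g = F' g" using f(3) f'(3) g by simp
    qed
  qed
  have "family_sum ?Q ?K ` families ?Q ?K (\<lambda>g. ?q \<inter> ?C g) = ?q"
  proof
    show "family_sum ?Q ?K ` families ?Q ?K (\<lambda>g. ?q \<inter> ?C g) \<subseteq> ?q"
      using idq by (auto simp: families_def ideal_def
          intro!: family_sum_mem[OF h.S.is_abelian_group])
    show "?q \<subseteq> family_sum ?Q ?K ` families ?Q ?K (\<lambda>g. ?q \<inter> ?C g)"
    proof
      fix y assume "y \<in> ?q"
      then obtain x where x: "x \<in> p" "y = ?h x" by (auto simp: quot_image_def)
      obtain f where f: "f \<in> families R ?K (\<lambda>g. p \<inter> RG g)" "family_sum R ?K f = x"
        using direct_sum_components p x(1) unfolding graded_ideal_def by metis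
      define L where "L = {g \<in> ?K. f g \<noteq> \<zero>\<^bsub>R\<^esub>}"
      have L: "finite L" "L \<subseteq> ?K" using f by (auto simp: L_def families_def)
      define F where "F = (\<lambda>g\<in>?K. ?h (f g))"
      have fp: "f g \<in> p \<inter> RG g" if "g \<in> ?K" for g using f that by (auto simp: families_def)
      have fc: "f g \<in> carrier R" if "g \<in> ?K" for g using fp[OF that] RGsub[OF that] by auto
      \<comment> \<open>The inclusion may be strict: a nonzero component of \<open>f\<close> that
        lies in \<open>A\<close> has zero coset.\<close>
      have supp: "{g \<in> ?K. F g \<noteq> \<zero>\<^bsub>?Q\<^esub>} \<subseteq> L" by (auto simp: F_def L_def)
      have "F \<in> families ?Q ?K (\<lambda>g. ?q \<inter> ?C g)"
        using fp finite_subset[OF supp L(1)] by (auto simp: families_def F_def quot_image_def)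
      moreover have "family_sum ?Q ?K F = y"
      proof -
        have "family_sum ?Q ?K F = (\<Oplus>\<^bsub>?Q\<^esub>g\<in>L. F g)"
          by (rule h.S.family_sum_eq_finsum) (use L fc supp in \<open>auto simp: F_def\<close>)
        also have "\<dots> = (\<Oplus>\<^bsub>?Q\<^esub>g\<in>L. (?h \<circ> f) g)"
          by (rule h.S.finsum_cong') (use L fc in \<open>auto simp: F_def\<close>)
        also have "\<dots> = ?h (\<Oplus>\<^bsub>R\<^esub>g\<in>L. f g)"
          by (rule h.hom_finsum[symmetric]) (use L fc in auto)
        finally show ?thesis using f(2) x(2) by (simp add: family_sum_def L_def)
      qed
      ultimately show "y \<in> family_sum ?Q ?K ` families ?Q ?K (\<lambda>g. ?q \<inter> ?C g)" by blast
    qed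
  qed
  then show ?thesis
    using idq addC inj by (simp add: graded_ideal_def is_direct_sum_def bij_betw_def)
qed

text \<open>Homogeneous cosets have homogeneous representatives, and lying in the image of
  \<open>p\<close> is the same as having representatives in \<open>p\<close>; properness and
  primality therefore carry over.\<close>

lemma graded_prime_ideal_quot_image:
  assumes A: "graded_ideal G R RG A" and p: "graded_prime_ideal G R RG p" and Ap: "A \<subseteq> p"
  shows "graded_prime_ideal G (R Quot A) (\<lambda>g. quot_image R A (RG g)) (quot_image R A p)"
proof -
  have gp: "graded_ideal G R RG p" and iA: "ideal A R" and ip: "ideal p R"
    using A p by (simp_all add: graded_prime_ideal_def graded_ideal_def)
  interpret h: ring_hom_cring R "R Quot A" "\<lambda>r. A +>\<^bsub>R\<^esub> r"
    using ideal.rcos_ring_hom_cring[OF iA R.is_cring] .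
  note mem = R.rcos_mem_quot_image_iff[OF iA ip Ap]
  have "quot_image R A p \<noteq> carrier (R Quot A)"
  proof
    assume *: "quot_image R A p = carrier (R Quot A)"
    have "carrier R \<subseteq> p" using mem h.hom_closed * by blast
    then show False using p ideal_subset_carrier[OF ip] by (auto simp: graded_prime_ideal_def)
  qed
  moreover have "x \<in> quot_image R A p \<or> y \<in> quot_image R A p"
    if x: "x \<in> homogeneous G (\<lambda>g. quot_image R A (RG g))"
      and y: "y \<in> homogeneous G (\<lambda>g. quot_image R A (RG g))"
      and xy: "x \<otimes>\<^bsub>R Quot A\<^esub> y \<in> quot_image R A p" for x y
  proof -
    obtain a b where ab: "a \<in> homogeneous G RG" "x = A +>\<^bsub>R\<^esub> a"
        "b \<in> homogeneous G RG" "y = A +>\<^bsub>R\<^esub> b"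
      using x y by (auto simp: homogeneous_def quot_image_def)
    then have c: "a \<in> carrier R" "b \<in> carrier R" using homogeneous_subset by auto
    have "a \<otimes>\<^bsub>R\<^esub> b \<in> p" using xy ab c mem[of "a \<otimes>\<^bsub>R\<^esub> b"] by simp
    then have "a \<in> p \<or> b \<in> p" using p ab by (auto simp: graded_prime_ideal_def)
    then show ?thesis using ab c mem by simp
  qed
  ultimately show ?thesis
    using graded_ideal_quot_image[OF A gp Ap] by (simp add: graded_prime_ideal_def)
qed

section \<open>Closed sets of the graded spectrum and minimal primes\<close>

text \<open>The witness is the graded ideal generated by \<open>J\<close> and \<open>a\<close>,
  built as an intersection; a graded prime containing both is one of the ideals intersected. In the
  Noetherian induction this cuts a closed set down to a smaller closed set.\<close>

lemma graded_V_insert: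
  assumes "graded_ideal G R RG J" and a: "a \<in> carrier R"
  obtains J' where "graded_ideal G R RG J'"
    and "graded_V G R RG J' = {p \<in> graded_V G R RG J. a \<in> p}"
proof -
  define S where "S = {I. graded_ideal G R RG I \<and> J \<subseteq> I \<and> a \<in> I}"
  have "J \<subseteq> carrier R" using assms ideal_subset_carrier by (auto simp: graded_ideal_def)
  \<comment> \<open>The whole ring makes \<open>S\<close> nonempty, so that its intersection is a
    graded ideal and not the universal set.\<close>
  then have "carrier R \<in> S" using a graded_ideal_carrier by (auto simp: S_def)
  then have "graded_ideal G R RG (\<Inter>S)" by (intro graded_ideal_Inter) (auto simp: S_def)
  moreover have "\<Inter>S \<subseteq> p \<longleftrightarrow> J \<subseteq> p \<and> a \<in> p" if "p \<in> graded_Spec G R RG" for p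
  proof
    assume "\<Inter>S \<subseteq> p"
    then show "J \<subseteq> p \<and> a \<in> p" by (auto simp: S_def)
  next
    assume "J \<subseteq> p \<and> a \<in> p"
    then have "p \<in> S" using that by (auto simp: S_def graded_Spec_def graded_prime_ideal_def)
    then show "\<Inter>S \<subseteq> p" by auto
  qed
  then have "graded_V G R RG (\<Inter>S) = {p \<in> graded_V G R RG J. a \<in> p}"
    by (auto simp: graded_V_def)
  ultimately show thesis using that by blast
qed

text \<open>
  Noetherian induction on the closed set: if the intersection of its members is not prime, a pair of
  homogeneous witnesses splits it into two strictly smaller closed sets.
\<close>

lemma noetherian_finite_lower_bounds:
  assumes noeth: "noetherian_space (graded_Zariski G R RG)" and J: "graded_ideal G R RG J"
  shows "\<exists>F. finite F \<and> F \<subseteq> graded_V G R RG J \<and> (\<forall>q\<in>graded_V G R RG J. \<exists>p\<in>F. p \<subseteq> q)"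
proof -
  let ?X = "graded_Zariski G R RG" and ?V = "graded_V G R RG"
  \<comment> \<open>The descending chain condition in the form needed for induction: an infinite
    strictly descending chain of closed sets would have to become stationary.\<close>
  have "wf {(C, D). closedin ?X C \<and> closedin ?X D \<and> C \<subset> D}"
    unfolding wf_iff_no_infinite_down_chain
  proof
    assume "\<exists>f. \<forall>i. (f (Suc i), f i) \<in> {(C, D). closedin ?X C \<and> closedin ?X D \<and> C \<subset> D}"
    then obtain f where "\<forall>i. closedin ?X (f (Suc i)) \<and> closedin ?X (f i) \<and> f (Suc i) \<subset> f i"
      by auto
    then have f: "\<And>i. closedin ?X (f i)" "\<And>i. f (Suc i) \<subset> f i" by blast+
    have "(\<forall>i. closedin ?X (f i)) \<and> (\<forall>i. f (Suc i) \<subseteq> f i)"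
      by (intro conjI allI f(1) psubset_imp_subset f(2))
    from noeth[unfolded noetherian_space_def, THEN spec, THEN mp, OF this]
    obtain n where "\<forall>m\<ge>n. f m = f n" by (elim exE)
    then have "n \<le> Suc n \<longrightarrow> f (Suc n) = f n" by (rule spec)
    then show False using f(2)[of n] by simp
  qed
  moreover have "closedin ?X C \<longrightarrow>
      (\<exists>F. finite F \<and> F \<subseteq> C \<and> (\<forall>q\<in>C. \<exists>p\<in>F. p \<subseteq> q))" for C
    using calculation
  proof (induction C rule: wf_induct_rule)
    case (less C)
    show ?case
    proof
      assume C: "closedin ?X C"
      then obtain J where J: "graded_ideal G R RG J" "C = ?V J"
        unfolding closedin_graded_Zariski by blast
      show "\<exists>F. finite F \<and> F \<subseteq> C \<and> (\<forall>q\<in>C. \<exists>p\<in>F. p \<subseteq> q)"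
      \<comment> \<open>If the intersection of \<open>C\<close> is a member of \<open>C\<close>, it
        is the least one and serves alone as lower bound.\<close>
      proof (cases "C = {} \<or> \<Inter>C \<in> C")
        case True
        then show ?thesis
        proof
          assume "C = {}"
          then show ?thesis by (intro exI[of _ "{}"]) simp
        next
          assume "\<Inter>C \<in> C"
          then show ?thesis by (intro exI[of _ "{\<Inter>C}"]) auto
        qed
      next
        case False
        have CS: "graded_prime_ideal G R RG p" if "p \<in> C" for p
          using that J(2) by (auto simp: graded_V_def graded_Spec_def)
        have gI: "graded_ideal G R RG (\<Inter>C)"
          using False CS by (intro graded_ideal_Inter) (auto simp: graded_prime_ideal_def)
        \<comment> \<open>\<open>J\<close> lies in every member of \<open>C\<close>, hence in the
          intersection; if the latter were a graded prime, it would belong to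
          \<open>C\<close>.\<close>
        have "\<Inter>C \<notin> graded_Spec G R RG"
          using False J(2) by (auto simp: graded_V_def)
        moreover have "\<Inter>C \<noteq> carrier R"
        proof
          assume "\<Inter>C = carrier R"
          moreover obtain p where p: "p \<in> C" using False by auto
          ultimately have "carrier R \<subseteq> p" by auto
          moreover have "p \<subseteq> carrier R" "p \<noteq> carrier R"
            using CS[OF p] ideal_subset_carrier
            by (auto simp: graded_prime_ideal_def graded_ideal_def)
          ultimately show False by simp
        qed
        ultimately obtain a b where ab: "a \<in> homogeneous G RG" "b \<in> homogeneous G RG"
            "a \<otimes>\<^bsub>R\<^esub> b \<in> \<Inter>C" "a \<notin> \<Inter>C" "b \<notin> \<Inter>C"
          using gI unfolding graded_Spec_def graded_prime_ideal_def by blast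
        \<comment> \<open>Every member of \<open>C\<close> is a graded prime containing the product
          of \<open>a\<close> and \<open>b\<close>. Both pieces are proper, because \<open>a\<close>
          and \<open>b\<close> are each missing from some member.\<close>
        have split: "C = {p \<in> C. a \<in> p} \<union> {p \<in> C. b \<in> p}"
          using ab CS unfolding graded_prime_ideal_def by blast
        have fin: "\<exists>F. finite F \<and> F \<subseteq> {p \<in> C. x \<in> p} \<and> (\<forall>q\<in>{p \<in> C. x \<in> p}. \<exists>p\<in>F. p \<subseteq> q)"
          if x: "x \<in> homogeneous G RG" "x \<notin> \<Inter>C" for x
        proof -
          obtain J' where "graded_ideal G R RG J'" "?V J' = {p \<in> C. x \<in> p}"
            using graded_V_insert[OF J(1)] x(1) homogeneous_subset J(2) by blast
          then have "closedin ?X {p \<in> C. x \<in> p}" unfolding closedin_graded_Zariski by metis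
          moreover have "{p \<in> C. x \<in> p} \<subset> C" using x(2) by auto
          ultimately show ?thesis using less C by blast
        qed
        from fin[OF ab(1,4)] obtain F1 where
          F1: "finite F1" "F1 \<subseteq> {p \<in> C. a \<in> p}" "\<forall>q\<in>{p \<in> C. a \<in> p}. \<exists>p\<in>F1. p \<subseteq> q"
          by (elim exE conjE)
        from fin[OF ab(2,5)] obtain F2 where
          F2: "finite F2" "F2 \<subseteq> {p \<in> C. b \<in> p}" "\<forall>q\<in>{p \<in> C. b \<in> p}. \<exists>p\<in>F2. p \<subseteq> q"
          by (elim exE conjE)
        have "\<exists>p\<in>F1 \<union> F2. p \<subseteq> q" if "q \<in> C" for q
        proof -
          have "q \<in> {p \<in> C. a \<in> p} \<or> q \<in> {p \<in> C. b \<in> p}" using that split by blast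
          then show ?thesis using F1(3) F2(3) by (meson UnI1 UnI2)
        qed
        then show ?thesis using F1(1,2) F2(1,2) by (intro exI[of _ "F1 \<union> F2"]) auto
      qed
    qed
  qed
  ultimately show ?thesis using J closedin_graded_Zariski by blast
qed

text \<open>An iteration of \<open>graded_V_Int\<close>: the closed set of an intersection of two
  graded ideals is the union of their closed sets.\<close>

lemma graded_prime_ideal_finite_Inter:
  assumes q: "graded_prime_ideal G R RG q" and "finite I" "I \<noteq> {}"
    and "\<And>i. i \<in> I \<Longrightarrow> graded_ideal G R RG (J i)" and "(\<Inter>i\<in>I. J i) \<subseteq> q"
  shows "\<exists>i\<in>I. J i \<subseteq> q"
  using assms(2-)
proof (induction I rule: finite_ne_induct)
  case (singleton i)
  then show ?case by simp
next
  case (insert i I)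
  have gI: "graded_ideal G R RG (\<Inter>i\<in>I. J i)"
    using insert by (intro graded_ideal_Inter) auto
  have "q \<in> graded_V G R RG (J i \<inter> (\<Inter>i\<in>I. J i))"
    using q insert.prems(2) by (simp add: graded_V_def graded_Spec_def)
  then have "J i \<subseteq> q \<or> (\<Inter>i\<in>I. J i) \<subseteq> q"
    using graded_V_Int[OF insert.prems(1)[of i] gI] by (auto simp: graded_V_def)
  then show ?case using insert by auto
qed

end

section \<open>Annihilators and sums of submodules, without gradings\<close>

context module
begin

lemma submonoid_submodule:
  "submodule N R M \<Longrightarrow> submonoid N (add_monoid M)"
  by (rule subgroup.subgroup_is_submonoid[OF submodule.axioms(1)])

text \<open>This kernel is what \<open>family_sum_mem\<close> and \<open>submodule_sum_least\<close>
  are applied to: an element that kills all summands kills the sum.\<close>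

lemma additive_subgroup_smult_kernel:
  assumes "a \<in> carrier R"
  shows "additive_subgroup {x \<in> carrier M. a \<odot>\<^bsub>M\<^esub> x = \<zero>\<^bsub>M\<^esub>} M"
  unfolding additive_subgroup_def
  by (rule M.add.subgroupI) (use assms in \<open>auto simp: smult_r_distr smult_r_minus simp flip: a_inv_def\<close>)

lemma finsum_smult_rdistr:
  assumes "x \<in> carrier M" "f \<in> A \<rightarrow> carrier R"
  shows "(\<Oplus>\<^bsub>R\<^esub>i\<in>A. f i) \<odot>\<^bsub>M\<^esub> x = (\<Oplus>\<^bsub>M\<^esub>i\<in>A. f i \<odot>\<^bsub>M\<^esub> x)"
  using assms(2)
  by (induction A rule: infinite_finite_induct) (use assms(1) in \<open>auto simp: smult_l_distr Pi_def\<close>)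

lemma ideal_Ann_ring:
  assumes "N \<subseteq> carrier M"
  shows "ideal (Ann_ring R M N) R"
proof (rule idealI)
  show "subgroup (Ann_ring R M N) (add_monoid R)"
    by (rule R.add.subgroupI)
      (use assms in \<open>auto simp: Ann_ring_def smult_l_distr smult_l_minus subset_eq simp flip: a_inv_def\<close>)
next
  fix a x assume "a \<in> Ann_ring R M N" "x \<in> carrier R"
  then show "x \<otimes>\<^bsub>R\<^esub> a \<in> Ann_ring R M N" "a \<otimes>\<^bsub>R\<^esub> x \<in> Ann_ring R M N"
    using assms by (auto simp: Ann_ring_def smult_assoc1 R.m_comm[of a x] subset_eq)
qed (rule R.ring_axioms)

lemma Ann_module_antimono: "I \<subseteq> J \<Longrightarrow> Ann_module M J \<subseteq> Ann_module M I"
  by (auto simp: Ann_module_def)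

lemma Ann_ring_antimono: "N \<subseteq> N' \<Longrightarrow> Ann_ring R M N' \<subseteq> Ann_ring R M N"
  by (auto simp: Ann_ring_def)

text \<open>The two annihilators form an inclusion-reversing Galois connection, and every
  annihilator is a closed element of it.\<close>

lemma Ann_module_Ann_ring_Ann_module:
  assumes "I \<subseteq> carrier R"
  shows "Ann_module M (Ann_ring R M (Ann_module M I)) = Ann_module M I"
  using assms by (auto simp: Ann_module_def Ann_ring_def subset_eq)

text \<open>Sums involve only addition and zero, so the facts about \<open>submodule_sum\<close> are
  phrased for additive submonoids; this covers submodules and kernels of ring elements
  alike.\<close>

lemma finsum_mem_submonoid:
  assumes X: "submonoid X (add_monoid M)" and "finite J" and "\<And>i. i \<in> J \<Longrightarrow> f i \<in> X"
  shows "(\<Oplus>\<^bsub>M\<^esub>i\<in>J. f i) \<in> X"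
  using assms(2,3)
proof (induction J rule: finite_induct)
  case empty
  then show ?case using submonoid.one_closed[OF X] by simp
next
  case (insert j J)
  have "X \<subseteq> carrier M" using submonoid.subset[OF X] by simp
  then have "f \<in> J \<rightarrow> carrier M" "f j \<in> carrier M" using insert.prems by auto
  then show ?case using insert submonoid.m_closed[OF X] by (simp add: M.finsum_insert)
qed

lemma submodule_sum_least:
  assumes "submonoid X (add_monoid M)" "\<And>i. i \<in> I \<Longrightarrow> N i \<subseteq> X"
  shows "submodule_sum M I N \<subseteq> X"
  using finsum_mem_submonoid[OF assms(1)] assms(2) unfolding submodule_sum_def by blast

lemma submodule_sum_upper:
  assumes "i \<in> I" "N i \<subseteq> carrier M"
  shows "N i \<subseteq> submodule_sum M I N"
proof
  fix x assume x: "x \<in> N i"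
  then have "(\<Oplus>\<^bsub>M\<^esub>j\<in>{i}. x) = x" using assms(2) by (subst M.finsum_insert) auto
  then show "x \<in> submodule_sum M I N"
    unfolding submodule_sum_def using x assms(1)
    by (intro CollectI exI[of _ "{i}"] exI[of _ "\<lambda>_. x"]) auto
qed

lemma submonoid_submodule_sum:
  assumes N: "\<And>i. i \<in> I \<Longrightarrow> submonoid (N i) (add_monoid M)"
  shows "submonoid (submodule_sum M I N) (add_monoid M)"
proof (rule submonoid.intro)
  have sub: "N i \<subseteq> carrier M" if "i \<in> I" for i
    using submonoid.subset[OF N[OF that]] by simp
  have "submonoid (carrier M) (add_monoid M)"
    by (rule submonoid_submodule[OF carrier_is_submodule])
  then show "submodule_sum M I N \<subseteq> carrier (add_monoid M)"
    using submodule_sum_least[of "carrier M" I N] sub by simp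
  show "\<one>\<^bsub>add_monoid M\<^esub> \<in> submodule_sum M I N"
    unfolding submodule_sum_def by (intro CollectI exI[of _ "{}"]) simp
  fix x y assume "x \<in> submodule_sum M I N" "y \<in> submodule_sum M I N"
  then obtain J f J' f' where J: "x = (\<Oplus>\<^bsub>M\<^esub>i\<in>J. f i)" "finite J" "J \<subseteq> I" "\<forall>i\<in>J. f i \<in> N i"
    and J': "y = (\<Oplus>\<^bsub>M\<^esub>i\<in>J'. f' i)" "finite J'" "J' \<subseteq> I" "\<forall>i\<in>J'. f' i \<in> N i"
    unfolding submodule_sum_def by blast
  \<comment> \<open>Both families are extended by zero, which lies in every \<open>N i\<close>, to
    the union of their index sets; the sums can then be added termwise.\<close>
  let ?e = "\<lambda>i. if i \<in> J then f i else \<zero>\<^bsub>M\<^esub>" and ?e' = "\<lambda>i. if i \<in> J' then f' i else \<zero>\<^bsub>M\<^esub>"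
  have mem: "?e i \<in> N i" "?e' i \<in> N i" if "i \<in> J \<union> J'" for i
    using that J J' submonoid.one_closed[OF N, of i] by auto
  then have c: "?e i \<in> carrier M" "?e' i \<in> carrier M" if "i \<in> J \<union> J'" for i
    using that sub[of i] J(3) J'(3) by blast+
  have "x = (\<Oplus>\<^bsub>M\<^esub>i\<in>J \<union> J'. ?e i)" "y = (\<Oplus>\<^bsub>M\<^esub>i\<in>J \<union> J'. ?e' i)"
    unfolding J(1) J'(1)
    by (rule M.add.finprod_mono_neutral_cong_left; use J(2) J'(2) c in force)+
  then have "x \<oplus>\<^bsub>M\<^esub> y = (\<Oplus>\<^bsub>M\<^esub>i\<in>J \<union> J'. ?e i \<oplus>\<^bsub>M\<^esub> ?e' i)"
    using c by (subst M.finsum_addf) auto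
  moreover have "\<forall>i\<in>J \<union> J'. ?e i \<oplus>\<^bsub>M\<^esub> ?e' i \<in> N i"
  proof
    fix i assume i: "i \<in> J \<union> J'"
    then have "i \<in> I" using J(3) J'(3) by blast
    from submonoid.m_closed[OF N[OF this] mem[OF i]] show "?e i \<oplus>\<^bsub>M\<^esub> ?e' i \<in> N i" by simp
  qed
  ultimately show "x \<otimes>\<^bsub>add_monoid M\<^esub> y \<in> submodule_sum M I N"
    unfolding submodule_sum_def using J J'
    by (intro CollectI exI[of _ "J \<union> J'"] exI[of _ "\<lambda>i. ?e i \<oplus>\<^bsub>M\<^esub> ?e' i"]) simp
qed

text \<open>Domination of members instead of inclusion of index sets: the index types may differ.
  Applied in both directions, it replaces an infinite family by a finite one and switches between
  indexing by primes and by submodules.\<close>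

lemma submodule_sum_mono:
  assumes "\<And>j. j \<in> J \<Longrightarrow> submonoid (N' j) (add_monoid M)"
    and "\<And>i. i \<in> I \<Longrightarrow> \<exists>j\<in>J. N i \<subseteq> N' j"
  shows "submodule_sum M I N \<subseteq> submodule_sum M J N'"
proof (rule submodule_sum_least[OF submonoid_submodule_sum[OF assms(1)]])
  fix i assume "i \<in> I"
  then obtain j where j: "j \<in> J" "N i \<subseteq> N' j" using assms(2) by blast
  have "N' j \<subseteq> carrier M" using submonoid.subset[OF assms(1)[OF j(1)]] by simp
  then show "N i \<subseteq> submodule_sum M J N'" using j submodule_sum_upper[of j J N'] by blast
qed

lemma submodule_sum_empty: "submodule_sum M {} N = {\<zero>\<^bsub>M\<^esub>}"
  by (auto simp: submodule_sum_def)

end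

section \<open>Graded second submodules and graded primes above the annihilator\<close>

context graded_module
begin

lemma module_component_additive_subgroup:
  "g \<in> carrier G \<Longrightarrow> additive_subgroup (MG g) M"
  using module_direct_sum by (simp add: is_direct_sum_def)

lemma graded_submodule_subset:
  "graded_submodule G R M MG N \<Longrightarrow> N \<subseteq> carrier M"
  by (auto simp: graded_submodule_def dest: submoduleE(1))

text \<open>
  Multiplying a homogeneous element of degree \<open>h\<close> by the components of \<open>r\<close> gives elements of
  pairwise distinct degrees, so if their sum vanishes each of them does.
\<close>

lemma graded_ideal_Ann_ring:
  assumes N: "graded_submodule G R M MG N"
  shows "graded_ideal G R RG (Ann_ring R M N)"
proof (rule graded_idealI)
  let ?K = "carrier G"
  have Nsub: "N \<subseteq> carrier M" by (rule graded_submodule_subset[OF N])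
  then show "ideal (Ann_ring R M N) R" by (rule ideal_Ann_ring)
  fix f assume f: "f \<in> families R ?K RG" and s: "family_sum R ?K f \<in> Ann_ring R M N"
  define L where "L = {g \<in> ?K. f g \<noteq> \<zero>\<^bsub>R\<^esub>}"
  have L: "finite L" "L \<subseteq> ?K" using f by (auto simp: L_def families_def)
  have fRG: "f g \<in> RG g" if "g \<in> ?K" for g using f that by (auto simp: families_def)
  have fc: "f g \<in> carrier R" if "g \<in> ?K" for g
    using fRG[OF that] component_additive_subgroup[OF that] additive_subgroup.a_subset by blast
  have hom: "f g \<odot>\<^bsub>M\<^esub> x = \<zero>\<^bsub>M\<^esub>" if g: "g \<in> ?K" and h: "h \<in> ?K" and x: "x \<in> N" "x \<in> MG h" for g h x
  proof -
    have xc: "x \<in> carrier M" using x Nsub by auto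
    \<comment> \<open>Shift of degree: the component of \<open>f\<close> that sends the degree of
      \<open>x\<close> to \<open>k\<close> has degree \<open>k\<close> times the inverse of
      \<open>h\<close>, so \<open>e k\<close> lies in \<open>MG k\<close>.\<close>
    define e where "e = (\<lambda>k\<in>?K. f (k \<otimes>\<^bsub>G\<^esub> inv\<^bsub>G\<^esub> h) \<odot>\<^bsub>M\<^esub> x)"
    let ?L = "(\<lambda>g. g \<otimes>\<^bsub>G\<^esub> h) ` L"
    have cancel: "k \<otimes>\<^bsub>G\<^esub> inv\<^bsub>G\<^esub> h \<otimes>\<^bsub>G\<^esub> h = k" "k \<otimes>\<^bsub>G\<^esub> h \<otimes>\<^bsub>G\<^esub> inv\<^bsub>G\<^esub> h = k" if "k \<in> ?K" for k
      using that h by (simp_all add: G.m_assoc)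
    have eM: "e k \<in> MG k" if k: "k \<in> ?K" for k
    proof -
      have kh: "k \<otimes>\<^bsub>G\<^esub> inv\<^bsub>G\<^esub> h \<in> ?K" using k h by simp
      show ?thesis
        using module_graded_smult[OF kh h fRG[OF kh] x(2)] k by (simp add: e_def cancel)
    qed
    have ec: "e k \<in> carrier M" if "k \<in> ?K" for k
      using eM[OF that] module_component_additive_subgroup[OF that] additive_subgroup.a_subset by blast
    have esupp: "{k \<in> ?K. e k \<noteq> \<zero>\<^bsub>M\<^esub>} \<subseteq> ?L"
    proof
      fix k assume "k \<in> {k \<in> ?K. e k \<noteq> \<zero>\<^bsub>M\<^esub>}"
      then have k: "k \<in> ?K" "f (k \<otimes>\<^bsub>G\<^esub> inv\<^bsub>G\<^esub> h) \<odot>\<^bsub>M\<^esub> x \<noteq> \<zero>\<^bsub>M\<^esub>" by (auto simp: e_def)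
      then have "k \<otimes>\<^bsub>G\<^esub> inv\<^bsub>G\<^esub> h \<in> L" using h xc by (auto simp: L_def)
      then show "k \<in> ?L" using cancel(1)[OF k(1)] by (metis imageI)
    qed
    have Lsub: "?L \<subseteq> ?K" using L h by auto
    have "e \<in> (\<Pi>\<^sub>E k\<in>?K. MG k)" using eM by (auto simp: e_def)
    then have e: "e \<in> families M ?K MG"
      using finite_subset[OF esupp] L(1) by (simp add: families_def)
    have eL: "e (g \<otimes>\<^bsub>G\<^esub> h) = f g \<odot>\<^bsub>M\<^esub> x" if "g \<in> ?K" for g
      using that h by (simp add: e_def cancel)
    have "family_sum M ?K e = (\<Oplus>\<^bsub>M\<^esub>k\<in>?L. e k)"
      by (rule M.family_sum_eq_finsum) (use L esupp Lsub ec in auto)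
    also have "\<dots> = (\<Oplus>\<^bsub>M\<^esub>g\<in>L. e (g \<otimes>\<^bsub>G\<^esub> h))"
    proof (rule M.finsum_reindex)
      show "e \<in> ?L \<rightarrow> carrier M" using ec Lsub by auto
      show "inj_on (\<lambda>g. g \<otimes>\<^bsub>G\<^esub> h) L"
        by (rule inj_on_inverseI[where g = "\<lambda>k. k \<otimes>\<^bsub>G\<^esub> inv\<^bsub>G\<^esub> h"], rule cancel(2)) (use L(2) in blast)
    qed
    also have "\<dots> = (\<Oplus>\<^bsub>M\<^esub>g\<in>L. f g \<odot>\<^bsub>M\<^esub> x)"
      by (rule M.finsum_cong') (use L fc xc eL in auto)
    also have "\<dots> = (\<Oplus>\<^bsub>R\<^esub>g\<in>L. f g) \<odot>\<^bsub>M\<^esub> x"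
      by (rule finsum_smult_rdistr[symmetric]) (use L fc xc in auto)
    also have "\<dots> = family_sum R ?K f \<odot>\<^bsub>M\<^esub> x" by (simp add: family_sum_def L_def)
    also have "\<dots> = \<zero>\<^bsub>M\<^esub>" using s x by (simp add: Ann_ring_def)
    finally have sum0: "family_sum M ?K e = \<zero>\<^bsub>M\<^esub>" .
    \<comment> \<open>The zero family, restricted to the index set because families are extensional.
      Uniqueness of the decomposition of zero forces \<open>e = z\<close>.\<close>
    define z where "z = (\<lambda>k\<in>?K. \<zero>\<^bsub>M\<^esub>)"
    have supp: "{k \<in> ?K. z k \<noteq> \<zero>\<^bsub>M\<^esub>} = {}" by (auto simp: z_def)
    have "z \<in> (\<Pi>\<^sub>E k\<in>?K. MG k)"
      using module_component_additive_subgroup additive_subgroup.zero_closed by (auto simp: z_def)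
    then have z: "z \<in> families M ?K MG" "family_sum M ?K z = \<zero>\<^bsub>M\<^esub>"
      unfolding families_def family_sum_def by (simp_all only: supp mem_Collect_eq) simp_all
    have "inj_on (family_sum M ?K) (families M ?K MG)"
      using module_direct_sum by (simp add: is_direct_sum_def bij_betw_def)
    then have "e = z" by (rule inj_onD[OF _ _ e z(1)]) (simp only: sum0 z(2))
    then show ?thesis using eL[OF g] g h by (simp add: z_def)
  qed
  show "\<forall>g\<in>?K. f g \<in> Ann_ring R M N"
  proof
    fix g assume g: "g \<in> ?K"
    have "f g \<odot>\<^bsub>M\<^esub> x = \<zero>\<^bsub>M\<^esub>" if x: "x \<in> N" for x
    proof -
      \<comment> \<open>A general \<open>x\<close> decomposes into homogeneous elements of
        \<open>N\<close>, since \<open>N\<close> is graded; \<open>f g\<close> kills each of them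
        and hence their sum.\<close>
      let ?X = "{x \<in> carrier M. f g \<odot>\<^bsub>M\<^esub> x = \<zero>\<^bsub>M\<^esub>}"
      obtain u where u: "u \<in> families M ?K (\<lambda>g. N \<inter> MG g)" "family_sum M ?K u = x"
        using direct_sum_components N x unfolding graded_submodule_def by metis
      have "u h \<in> ?X" if h: "h \<in> ?K" for h
      proof -
        have "u h \<in> N" "u h \<in> MG h" using u(1) h by (auto simp: families_def)
        then show ?thesis using hom[OF g h] Nsub by auto
      qed
      then have "family_sum M ?K u \<in> ?X"
        by (intro family_sum_mem[OF M.abelian_group_axioms additive_subgroup_smult_kernel[OF fc[OF g]]])
      then show ?thesis using u(2) by simp
    qed
    then show "f g \<in> Ann_ring R M N" using fc[OF g] by (simp add: Ann_ring_def)
  qed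
qed

lemma graded_second_submodule:
  assumes "graded_second G R RG M MG S"
  shows "submodule S R M" "S \<subseteq> carrier M" "S \<noteq> {\<zero>\<^bsub>M\<^esub>}"
  using assms graded_submodule_subset by (auto simp: graded_second_def graded_submodule_def)

text \<open>If \<open>b\<close> maps \<open>S\<close> onto \<open>S\<close>, every element of
  \<open>S\<close> is a multiple of \<open>b\<close>, so a product \<open>ab\<close> killing
  \<open>S\<close> makes \<open>a\<close> kill \<open>S\<close>; otherwise \<open>b\<close> itself
  kills \<open>S\<close>. Properness holds because 1 does not kill a nonzero module.\<close>

lemma graded_prime_ideal_Ann_ring:
  assumes S: "graded_second G R RG M MG S"
  shows "graded_prime_ideal G R RG (Ann_ring R M S)"
proof -
  note sub = graded_second_submodule[OF S]
  have "Ann_ring R M S \<noteq> carrier R"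
  proof
    assume "Ann_ring R M S = carrier R"
    then have "\<one>\<^bsub>R\<^esub> \<in> Ann_ring R M S" by simp
    have "x = \<zero>\<^bsub>M\<^esub>" if "x \<in> S" for x
    proof -
      have "\<one>\<^bsub>R\<^esub> \<odot>\<^bsub>M\<^esub> x = \<zero>\<^bsub>M\<^esub>"
        using \<open>\<one>\<^bsub>R\<^esub> \<in> Ann_ring R M S\<close> that by (simp add: Ann_ring_def)
      moreover have "x \<in> carrier M" using that sub(2) by blast
      ultimately show ?thesis by simp
    qed
    then show False using sub(3) submoduleE(2)[OF sub(1)] by blast
  qed
  moreover have "a \<in> Ann_ring R M S \<or> b \<in> Ann_ring R M S"
    if a: "a \<in> homogeneous G RG" and b: "b \<in> homogeneous G RG"
      and ab: "a \<otimes>\<^bsub>R\<^esub> b \<in> Ann_ring R M S" for a b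
  proof -
    have c: "a \<in> carrier R" "b \<in> carrier R" using a b homogeneous_subset by auto
    from S b consider "(\<lambda>x. b \<odot>\<^bsub>M\<^esub> x) ` S = S" | "(\<lambda>x. b \<odot>\<^bsub>M\<^esub> x) ` S = {\<zero>\<^bsub>M\<^esub>}"
      unfolding graded_second_def by blast
    then show ?thesis
    proof cases
      case 1
      have "a \<odot>\<^bsub>M\<^esub> y = \<zero>\<^bsub>M\<^esub>" if "y \<in> S" for y
      proof -
        have "y \<in> (\<lambda>x. b \<odot>\<^bsub>M\<^esub> x) ` S" unfolding 1 by (rule that)
        then obtain x where x: "x \<in> S" "y = b \<odot>\<^bsub>M\<^esub> x" by (elim imageE)
        then show ?thesis using ab c sub(2) smult_assoc1[of a b x] by (auto simp: Ann_ring_def)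
      qed
      then show ?thesis using c by (simp add: Ann_ring_def)
    next
      case 2
      then show ?thesis using c by (auto simp: Ann_ring_def)
    qed
  qed
  ultimately show ?thesis
    using graded_ideal_Ann_ring S by (simp add: graded_prime_ideal_def graded_second_def)
qed

text \<open>Transfers surjectivity from the spectrum of the quotient by the annihilator of
  \<open>M\<close> back to \<open>R\<close>: the image of \<open>p\<close> is a graded prime there,
  hence the image of the annihilator of some \<open>S\<close>, and the correspondence of ideals
  cancels the quotient map.\<close>

lemma secondful_obtains_second:
  assumes sf: "graded_secondful G R RG M MG"
    and p: "p \<in> graded_V G R RG (Ann_ring R M (carrier M))"
  obtains S where "graded_second G R RG M MG S" "Ann_ring R M S = p"
proof -
  let ?A = "Ann_ring R M (carrier M)"
  have "graded_submodule G R M MG (carrier M)"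
  proof -
    have "carrier M \<inter> MG g = MG g" if "g \<in> carrier G" for g
      using module_component_additive_subgroup[OF that] additive_subgroup.a_subset by blast
    then have "families M (carrier G) (\<lambda>g. carrier M \<inter> MG g) = families M (carrier G) MG"
      unfolding families_def by (auto simp: PiE_iff)
    then show ?thesis
      using module_direct_sum carrier_is_submodule module_component_additive_subgroup
        \<open>\<And>g. g \<in> carrier G \<Longrightarrow> carrier M \<inter> MG g = MG g\<close>
      by (simp add: graded_submodule_def is_direct_sum_def)
  qed
  then have gA: "graded_ideal G R RG ?A" by (rule graded_ideal_Ann_ring)
  have gp: "graded_prime_ideal G R RG p" and Ap: "?A \<subseteq> p"
    using p by (auto simp: graded_V_def graded_Spec_def)
  have "quot_image R ?A p \<in> graded_Spec G (R Quot ?A) (\<lambda>g. quot_image R ?A (RG g))"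
    using graded_prime_ideal_quot_image[OF gA gp Ap] by (simp add: graded_Spec_def)
  then have "quot_image R ?A p \<in> (\<lambda>S. quot_image R ?A (Ann_ring R M S)) ` second_Spec G R RG M MG"
    using sf by (simp add: graded_secondful_def Let_def)
  then obtain S where S: "graded_second G R RG M MG S"
      "quot_image R ?A p = quot_image R ?A (Ann_ring R M S)"
    by (auto simp: second_Spec_def)
  have "ideal (Ann_ring R M S) R" "?A \<subseteq> Ann_ring R M S"
    using graded_second_submodule[OF S(1)] ideal_Ann_ring Ann_ring_antimono by auto
  moreover have "ideal ?A R" "ideal p R"
    using gA gp by (simp_all add: graded_prime_ideal_def graded_ideal_def)
  ultimately have "Ann_ring R M S = p"
    using inj_onD[OF R.inj_on_quot_image[of ?A] S(2)] Ap by simp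
  then show thesis using that S(1) by blast
qed

lemma weak_comultiplication_second_eq:
  assumes "graded_weak_comultiplication G R RG M MG" and S: "graded_second G R RG M MG S"
  shows "Ann_module M (Ann_ring R M S) = S"
proof -
  obtain I where I: "graded_ideal G R RG I" "S = Ann_module M I"
    using assms by (auto simp: graded_weak_comultiplication_def second_Spec_def)
  have "I \<subseteq> carrier R" using I(1) ideal_subset_carrier[of I R] by (simp add: graded_ideal_def)
  then show ?thesis unfolding I(2) by (rule Ann_module_Ann_ring_Ann_module)
qed

lemma graded_V_Ann_ring_subset:
  assumes "N \<subseteq> carrier M"
  shows "graded_V G R RG (Ann_ring R M N) \<subseteq> graded_V G R RG (Ann_ring R M (carrier M))"
  using Ann_ring_antimono[OF assms] by (auto simp: graded_V_def)

text \<open>Secondfulness supplies some \<open>S\<close> with annihilator \<open>p\<close>; weak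
  comultiplication then identifies this \<open>S\<close> with \<open>Ann_module M p\<close>.\<close>

lemma graded_second_Ann_module:
  assumes "graded_secondful G R RG M MG" "graded_weak_comultiplication G R RG M MG"
    and "p \<in> graded_V G R RG (Ann_ring R M (carrier M))"
  shows "graded_second G R RG M MG (Ann_module M p)" "Ann_ring R M (Ann_module M p) = p"
  using secondful_obtains_second[OF assms(1,3)] weak_comultiplication_second_eq[OF assms(2)] by metis+

text \<open>Under the bijection between second submodules and primes, the condition defining
  \<open>second_V\<close> becomes membership of the prime in a closed set. Socles thereby turn into
  sums indexed by primes.\<close>

lemma second_V_eq:
  assumes "graded_secondful G R RG M MG" "graded_weak_comultiplication G R RG M MG"
    and N: "N \<subseteq> carrier M"
  shows "second_V G R RG M MG N = Ann_module M ` graded_V G R RG (Ann_ring R M N)"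
proof
  show "second_V G R RG M MG N \<subseteq> Ann_module M ` graded_V G R RG (Ann_ring R M N)"
  proof
    fix S assume "S \<in> second_V G R RG M MG N"
    then have S: "graded_second G R RG M MG S" "Ann_ring R M N \<subseteq> Ann_ring R M S"
      by (auto simp: second_V_def second_Spec_def)
    then have "Ann_ring R M S \<in> graded_V G R RG (Ann_ring R M N)"
      using graded_prime_ideal_Ann_ring by (simp add: graded_V_def graded_Spec_def)
    then show "S \<in> Ann_module M ` graded_V G R RG (Ann_ring R M N)"
      using weak_comultiplication_second_eq[OF assms(2) S(1)] by (metis imageI)
  qed
  show "Ann_module M ` graded_V G R RG (Ann_ring R M N) \<subseteq> second_V G R RG M MG N"
  proof
    fix S assume "S \<in> Ann_module M ` graded_V G R RG (Ann_ring R M N)"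
    then obtain p where p: "p \<in> graded_V G R RG (Ann_ring R M N)" "S = Ann_module M p" by blast
    then have "p \<in> graded_V G R RG (Ann_ring R M (carrier M))"
      using graded_V_Ann_ring_subset[OF N] by blast
    note graded_second_Ann_module[OF assms(1,2) this]
    moreover have "Ann_ring R M N \<subseteq> p" using p(1) by (simp add: graded_V_def)
    ultimately show "S \<in> second_V G R RG M MG N"
      using p(2) by (simp add: second_V_def second_Spec_def)
  qed
qed

section \<open>Zariski socles as sums of annihilators of primes\<close>

text \<open>Since \<open>Ann_module\<close> reverses inclusion, finitely many primes below all
  others give finitely many annihilators that contain all others. An empty \<open>F\<close> is
  possible and yields the zero submodule.\<close>

lemma socle_submodule_finite_sum:
  assumes noeth: "noetherian_space (graded_Zariski G R RG)"
    and sf: "graded_secondful G R RG M MG" and wc: "graded_weak_comultiplication G R RG M MG"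
    and N: "Zariski_socle_submodule G R RG M MG N"
  obtains F where "finite F" "F \<subseteq> graded_V G R RG (Ann_ring R M N)"
    and "N = submodule_sum M F (Ann_module M)"
proof -
  let ?V = "graded_V G R RG (Ann_ring R M N)"
  have gN: "graded_submodule G R M MG N" and soc: "N = Zariski_socle G R RG M MG N"
    using N by (auto simp: Zariski_socle_submodule_def)
  have Nsub: "N \<subseteq> carrier M" by (rule graded_submodule_subset[OF gN])
  note V = second_V_eq[OF sf wc Nsub]
  obtain F where F: "finite F" "F \<subseteq> ?V" "\<forall>q\<in>?V. \<exists>p\<in>F. p \<subseteq> q"
    using noetherian_finite_lower_bounds[OF noeth graded_ideal_Ann_ring[OF gN]] by blast
  have mon: "submonoid (Ann_module M p) (add_monoid M)" if "p \<in> ?V" for p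
    using graded_second_Ann_module(1)[OF sf wc] graded_V_Ann_ring_subset[OF Nsub] that
      submonoid_submodule graded_second_submodule(1) by blast
  have "submodule_sum M (Ann_module M ` ?V) (\<lambda>S. S) \<subseteq> submodule_sum M F (Ann_module M)"
  proof (rule submodule_sum_mono)
    fix S assume "S \<in> Ann_module M ` ?V"
    then obtain q where q: "q \<in> ?V" "S = Ann_module M q" by blast
    then obtain p where "p \<in> F" "p \<subseteq> q" using F(3) by blast
    then show "\<exists>p\<in>F. S \<subseteq> Ann_module M p" using q(2) Ann_module_antimono by blast
  qed (use F(2) mon in blast)
  moreover have "submodule_sum M F (Ann_module M) \<subseteq> submodule_sum M (Ann_module M ` ?V) (\<lambda>S. S)"
  proof (rule submodule_sum_mono)
    fix p assume "p \<in> F"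
    then show "\<exists>S\<in>Ann_module M ` ?V. Ann_module M p \<subseteq> S" using F(2) by blast
  qed (use mon in blast)
  ultimately have "N = submodule_sum M F (Ann_module M)"
    using soc V by (simp add: Zariski_socle_def)
  then show thesis using that F by blast
qed

text \<open>The zero submodule is annihilated by the whole ring, which no graded prime contains, so
  the socle is an empty sum.\<close>

lemma Zariski_socle_zero:
  assumes sf: "graded_secondful G R RG M MG" and wc: "graded_weak_comultiplication G R RG M MG"
  shows "Zariski_socle G R RG M MG {\<zero>\<^bsub>M\<^esub>} = {\<zero>\<^bsub>M\<^esub>}"
proof -
  have "Ann_ring R M {\<zero>\<^bsub>M\<^esub>} = carrier R" by (auto simp: Ann_ring_def)
  moreover have "graded_V G R RG (carrier R) = {}"
    using ideal_subset_carrier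
    by (auto simp: graded_V_def graded_Spec_def graded_prime_ideal_def graded_ideal_def)
  ultimately show ?thesis
    using second_V_eq[OF sf wc, of "{\<zero>\<^bsub>M\<^esub>}"] by (simp add: Zariski_socle_def submodule_sum_empty)
qed

text \<open>Each \<open>p i\<close> lies above the annihilator of \<open>N\<close>, so its summand
  occurs in the socle. Conversely, a prime \<open>q\<close> above that annihilator contains some
  \<open>p i\<close>, so the summand of \<open>q\<close> lies inside that of
  \<open>p i\<close>.\<close>

lemma Zariski_socle_sum_Ann_module:
  assumes sf: "graded_secondful G R RG M MG" and wc: "graded_weak_comultiplication G R RG M MG"
    and gN: "graded_submodule G R M MG N"
    and I: "finite I" "I \<noteq> {}" and p: "\<And>i. i \<in> I \<Longrightarrow> p i \<in> graded_V G R RG (Ann_ring R M N)"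
    and N: "N = submodule_sum M I (\<lambda>i. Ann_module M (p i))"
  shows "Zariski_socle G R RG M MG N = N"
proof
  let ?V = "graded_V G R RG (Ann_ring R M N)"
  have Nsub: "N \<subseteq> carrier M" by (rule graded_submodule_subset[OF gN])
  have soc: "Zariski_socle G R RG M MG N = submodule_sum M (Ann_module M ` ?V) (\<lambda>S. S)"
    by (simp add: Zariski_socle_def second_V_eq[OF sf wc Nsub])
  have mon: "submonoid (Ann_module M q) (add_monoid M)" if "q \<in> ?V" for q
    using graded_second_Ann_module(1)[OF sf wc] graded_V_Ann_ring_subset[OF Nsub] that
      submonoid_submodule graded_second_submodule(1) by blast
  have gi: "graded_ideal G R RG (p i)" if "i \<in> I" for i
    using p[OF that] by (auto simp: graded_V_def graded_Spec_def graded_prime_ideal_def)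
  have "submodule_sum M I (\<lambda>i. Ann_module M (p i)) \<subseteq> submodule_sum M (Ann_module M ` ?V) (\<lambda>S. S)"
  proof (rule submodule_sum_mono)
    fix i assume "i \<in> I"
    then show "\<exists>S\<in>Ann_module M ` ?V. Ann_module M (p i) \<subseteq> S" using p by blast
  qed (use mon in blast)
  then show "N \<subseteq> Zariski_socle G R RG M MG N" using soc N by simp
  \<comment> \<open>An element common to all \<open>p i\<close> kills every
    \<open>Ann_module M (p i)\<close>, hence their sum \<open>N\<close>.\<close>
  have "(\<Inter>i\<in>I. p i) \<subseteq> Ann_ring R M N"
  proof
    fix r assume r: "r \<in> (\<Inter>i\<in>I. p i)"
    have rc: "r \<in> carrier R"
      using r I(2) gi ideal_subset_carrier unfolding graded_ideal_def by blast
    have "submodule_sum M I (\<lambda>i. Ann_module M (p i)) \<subseteq> {x \<in> carrier M. r \<odot>\<^bsub>M\<^esub> x = \<zero>\<^bsub>M\<^esub>}"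
    proof (rule submodule_sum_least)
      show "submonoid {x \<in> carrier M. r \<odot>\<^bsub>M\<^esub> x = \<zero>\<^bsub>M\<^esub>} (add_monoid M)"
        by (rule subgroup.subgroup_is_submonoid[OF additive_subgroup.a_subgroup[OF
                additive_subgroup_smult_kernel[OF rc]]])
    qed (use r in \<open>auto simp: Ann_module_def\<close>)
    then show "r \<in> Ann_ring R M N" using N rc by (auto simp: Ann_ring_def)
  qed
  then have above: "\<exists>i\<in>I. p i \<subseteq> q" if "q \<in> ?V" for q
    using that graded_prime_ideal_finite_Inter[OF _ I gi, of q]
    by (auto simp: graded_V_def graded_Spec_def)
  have "submodule_sum M (Ann_module M ` ?V) (\<lambda>S. S) \<subseteq> submodule_sum M I (\<lambda>i. Ann_module M (p i))"
  proof (rule submodule_sum_mono)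
    fix S assume "S \<in> Ann_module M ` ?V"
    then obtain q where q: "q \<in> ?V" "S = Ann_module M q" by blast
    then obtain i where "i \<in> I" "p i \<subseteq> q" using above by blast
    then show "\<exists>i\<in>I. S \<subseteq> Ann_module M (p i)" using q(2) Ann_module_antimono by blast
  qed (use p mon in blast)
  then show "Zariski_socle G R RG M MG N \<subseteq> N" using soc N by simp
qed

end

theorem theorem4p8:
  fixes G :: "('g, 'k) monoid_scheme"
    and R :: "('a, 'r) ring_scheme" and RG :: "'g \<Rightarrow> 'a set"
    and M :: "('a, 'm, 'n) module_scheme" and MG :: "'g \<Rightarrow> 'm set"
  assumes "graded_ring G R RG"
    and "noetherian_space (graded_Zariski G R RG)"
    and "graded_module G R RG M MG"
    and "carrier M \<noteq> {\<zero>\<^bsub>M\<^esub>}"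
    and "graded_secondful G R RG M MG"
    and "graded_weak_comultiplication G R RG M MG"
  shows "(\<forall>N. Zariski_socle_submodule G R RG M MG N \<longrightarrow>
            (\<exists>F. finite F \<and> (\<forall>S\<in>F. graded_second G R RG M MG S) \<and>
                 N = submodule_sum M F (\<lambda>S. S))) \<and>
         (\<forall>N. graded_submodule G R M MG N \<longrightarrow>
            (Zariski_socle_submodule G R RG M MG N \<longleftrightarrow>
               N = {\<zero>\<^bsub>M\<^esub>} \<or>
               (\<exists>n::nat. n \<ge> 1 \<and>
                 (\<exists>p :: nat \<Rightarrow> 'a set.
                    (\<forall>i\<in>{1..n}. p i \<in> graded_V G R RG (Ann_ring R M N)) \<and>
                    N = submodule_sum M {1..n} (\<lambda>i. Ann_module M (p i))))))"
proof -
  interpret graded_module G R RG M MG by (rule assms(3))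
  note sf = assms(5) and wc = assms(6)
  have second: "graded_second G R RG M MG (Ann_module M p)"
    if "p \<in> graded_V G R RG (Ann_ring R M N)" "N \<subseteq> carrier M" for p N
    using graded_second_Ann_module(1)[OF sf wc] graded_V_Ann_ring_subset that by blast
  \<comment> \<open>Repetitions under \<open>h\<close> are absorbed, since the two sums dominate
    each other. This passes from sums over primes to sums over submodules or over an initial segment
    of the numbers.\<close>
  have reindex: "submodule_sum M (h ` I) N = submodule_sum M I (\<lambda>i. N (h i))"
    if "\<And>i. i \<in> I \<Longrightarrow> graded_second G R RG M MG (N (h i))"
    for I :: "'y set" and h :: "'y \<Rightarrow> 'z" and N :: "'z \<Rightarrow> 'm set"
    using that submonoid_submodule graded_second_submodule(1)
    by (intro equalityI submodule_sum_mono) blast+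
  show ?thesis
  proof (intro conjI allI impI)
    fix N assume N: "Zariski_socle_submodule G R RG M MG N"
    then have Nsub: "N \<subseteq> carrier M"
      using graded_submodule_subset by (simp add: Zariski_socle_submodule_def)
    obtain F where F: "finite F" "F \<subseteq> graded_V G R RG (Ann_ring R M N)"
        "N = submodule_sum M F (Ann_module M)"
      using socle_submodule_finite_sum[OF assms(2) sf wc N] .
    have snd: "graded_second G R RG M MG (Ann_module M p)" if "p \<in> F" for p
      using second F(2) Nsub that by blast
    have "N = submodule_sum M (Ann_module M ` F) (\<lambda>S. S)"
      using F(3) reindex[of F "\<lambda>S. S" "Ann_module M"] snd by simp
    then show "\<exists>F. finite F \<and> (\<forall>S\<in>F. graded_second G R RG M MG S) \<and>
        N = submodule_sum M F (\<lambda>S. S)"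
      using F(1) snd by (intro exI[of _ "Ann_module M ` F"]) simp
  next
    fix N assume gN: "graded_submodule G R M MG N"
    have Nsub: "N \<subseteq> carrier M" by (rule graded_submodule_subset[OF gN])
    let ?V = "graded_V G R RG (Ann_ring R M N)"
    let ?rhs = "N = {\<zero>\<^bsub>M\<^esub>} \<or> (\<exists>n::nat. n \<ge> 1 \<and> (\<exists>p :: nat \<Rightarrow> 'a set.
        (\<forall>i\<in>{1..n}. p i \<in> ?V) \<and> N = submodule_sum M {1..n} (\<lambda>i. Ann_module M (p i))))"
    show "Zariski_socle_submodule G R RG M MG N \<longleftrightarrow> ?rhs"
    proof
      assume N: "Zariski_socle_submodule G R RG M MG N"
      obtain F where F: "finite F" "F \<subseteq> ?V" "N = submodule_sum M F (Ann_module M)"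
        using socle_submodule_finite_sum[OF assms(2) sf wc N] .
      show ?rhs
      \<comment> \<open>The sum over \<open>n\<close> at least 1 cannot cover an empty
        \<open>F\<close>; that case is the alternative \<open>N = 0\<close>.\<close>
      proof (cases "F = {}")
        case True
        then show ?thesis using F(3) by (simp add: submodule_sum_empty)
      next
        case False
        obtain p where p: "bij_betw p {1..card F} F"
          using ex_bij_betw_nat_finite_1[OF F(1)] by blast
        then have im: "p ` {1..card F} = F" by (simp add: bij_betw_def)
        then have pV: "p i \<in> ?V" if "i \<in> {1..card F}" for i using that F(2) by blast
        then have "N = submodule_sum M {1..card F} (\<lambda>i. Ann_module M (p i))"
          using F(3) reindex[of "{1..card F}" "Ann_module M" p] second[OF pV Nsub] im by simp
        moreover have "card F \<ge> 1" using False F(1) by (simp add: Suc_le_eq card_gt_0_iff)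
        ultimately show ?thesis using pV by blast
      qed
    next
      assume ?rhs
      then show "Zariski_socle_submodule G R RG M MG N"
      proof
        assume "N = {\<zero>\<^bsub>M\<^esub>}"
        then show ?thesis
          using gN Zariski_socle_zero[OF sf wc] by (simp add: Zariski_socle_submodule_def)
      next
        assume "\<exists>n::nat. n \<ge> 1 \<and> (\<exists>p :: nat \<Rightarrow> 'a set.
          (\<forall>i\<in>{1..n}. p i \<in> ?V) \<and> N = submodule_sum M {1..n} (\<lambda>i. Ann_module M (p i)))"
        then obtain n :: nat and p where n: "n \<ge> 1" "\<forall>i\<in>{1..n}. p i \<in> ?V"
            "N = submodule_sum M {1..n} (\<lambda>i. Ann_module M (p i))" by blast
        have "Zariski_socle G R RG M MG N = N"
          by (rule Zariski_socle_sum_Ann_module[OF sf wc gN _ _ _ n(3)]) (use n in auto)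
        then show ?thesis using gN by (simp add: Zariski_socle_submodule_def)
      qed
    qed
  qed
qed

end
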